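(* Let $\mathcal{H}$ be an infinite-dimensional separable complex Hilbert space and let $T$ be a hyponormal bounded linear operator on $\mathcal{H}$ that is not a scalar multiple of the identity. Suppose that there exists an orthonormal basis $\mathcal{E}=\{e_n\}_{n\in\mathbb{N}}$ of $\mathcal{H}$ such that $T=R+V$, where $R$ is a bounded operator that is tridiagonal with respect to $\mathcal{E}$ and $V$ is a trace-class operator. Then $T$ has a nontrivial closed hyperinvariant subspace.
   Context: A bounded operator $T$ is hyponormal if its self-commutator $[T^*,T]=T^*T-TT^*$ is positive semi-definite. A bounded operator $R$ is tridiagonal with respect to an (ordered) orthonormal basis $\{e_n\}_{n\in\mathbb{N}}$ if $\langle R e_n,e_m\rangle=0$ whenever $|m-n|\geq 2$. A closed subspace $M$ is hyperinvariant for $T$ if it is invariant under every bounded operator commuting with $T$; it is nontrivial if $M\neq\{0\}$ and $M\neq\mathcal{H}$. *)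

theory Defs
  imports "HOL-Analysis.Analysis"
begin

text \<open>
  Complex Hilbert spaces. The class extends the real Banach spaces of the library, so that norm,
  topology and completeness are the library's; the last axiom says that the norm is the one induced
  by the inner product, and thereby also gives positive definiteness. The inner product is linear
  in the first argument.
\<close>

class complex_hilbert_space = banach +
  fixes scaleC :: "complex \<Rightarrow> 'a \<Rightarrow> 'a" (infixr "*\<^sub>C" 75)
    and cinner :: "'a \<Rightarrow> 'a \<Rightarrow> complex"
  assumes scaleC_add_right: "c *\<^sub>C (x + y) = c *\<^sub>C x + c *\<^sub>C y"
    and scaleC_add_left: "(c + d) *\<^sub>C x = c *\<^sub>C x + d *\<^sub>C x"
    and scaleC_scaleC: "c *\<^sub>C d *\<^sub>C x = (c * d) *\<^sub>C x"
    and scaleR_scaleC: "r *\<^sub>R x = complex_of_real r *\<^sub>C x"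
    and cinner_add_left: "cinner (x + y) z = cinner x z + cinner y z"
    and cinner_scaleC_left: "cinner (c *\<^sub>C x) y = c * cinner x y"
    and cinner_commute: "cinner x y = cnj (cinner y x)"
    and cinner_self: "cinner x x = complex_of_real ((norm x)\<^sup>2)"

global_interpretation complex_vector:
  vector_space "scaleC :: complex \<Rightarrow> 'a \<Rightarrow> 'a::complex_hilbert_space"
  by unfold_locales
    (simp_all add: scaleC_add_right scaleC_add_left scaleC_scaleC
      scaleR_scaleC[of 1, simplified, symmetric])

definition infinite_dimensional :: "'a::complex_hilbert_space itself \<Rightarrow> bool" where
  "infinite_dimensional _ \<longleftrightarrow>
     \<not> (\<exists>B :: 'a set. finite B \<and> complex_vector.span B = UNIV)"

definition bounded_operator :: "('a::complex_hilbert_space \<Rightarrow> 'a) \<Rightarrow> bool" where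
  "bounded_operator T \<longleftrightarrow> bounded_linear T \<and> (\<forall>c x. T (c *\<^sub>C x) = c *\<^sub>C T x)"

text \<open>Only meaningful for bounded operators, where the adjoint exists by Riesz representation.\<close>

definition cadjoint :: "('a::complex_hilbert_space \<Rightarrow> 'a) \<Rightarrow> 'a \<Rightarrow> 'a" where
  "cadjoint T = (THE S. \<forall>x y. cinner (S x) y = cinner x (T y))"

definition positive_operator :: "('a::complex_hilbert_space \<Rightarrow> 'a) \<Rightarrow> bool" where
  "positive_operator A \<longleftrightarrow> bounded_operator A \<and> (\<forall>x. cinner (A x) x \<in> \<real>\<^sub>\<ge>\<^sub>0)"

definition self_commutator :: "('a::complex_hilbert_space \<Rightarrow> 'a) \<Rightarrow> 'a \<Rightarrow> 'a" where
  "self_commutator T = (\<lambda>x. cadjoint T (T x) - T (cadjoint T x))"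

definition hyponormal :: "('a::complex_hilbert_space \<Rightarrow> 'a) \<Rightarrow> bool" where
  "hyponormal T \<longleftrightarrow> bounded_operator T \<and> positive_operator (self_commutator T)"

definition orthonormal_basis :: "'i set \<Rightarrow> ('i \<Rightarrow> 'a::complex_hilbert_space) \<Rightarrow> bool" where
  "orthonormal_basis I e \<longleftrightarrow>
     (\<forall>i\<in>I. \<forall>j\<in>I. cinner (e i) (e j) = (if i = j then 1 else 0)) \<and>
     closure (complex_vector.span (e ` I)) = UNIV"

definition tridiagonal :: "(nat \<Rightarrow> 'a) \<Rightarrow> ('a::complex_hilbert_space \<Rightarrow> 'a) \<Rightarrow> bool" where
  "tridiagonal e R \<longleftrightarrow>
     (\<forall>m n. \<bar>int m - int n\<bar> \<ge> 2 \<longrightarrow> cinner (R (e n)) (e m) = 0)"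

text \<open>
  \<open>A\<close> is \<open>|V|\<close>, the positive square root of \<open>V\<^sup>* V\<close>; it exists and is unique for each bounded
  operator \<open>V\<close>.
\<close>

definition is_modulus :: "('a::complex_hilbert_space \<Rightarrow> 'a) \<Rightarrow> ('a \<Rightarrow> 'a) \<Rightarrow> bool" where
  "is_modulus A V \<longleftrightarrow> positive_operator A \<and> A \<circ> A = cadjoint V \<circ> V"

text \<open>
  The trace of \<open>|V|\<close> is finite. Its terms are nonnegative and its value does not depend on the
  orthonormal basis \<open>E\<close>, so it is enough to ask for one.
\<close>

definition trace_class :: "('a::complex_hilbert_space \<Rightarrow> 'a) \<Rightarrow> bool" where
  "trace_class V \<longleftrightarrow> bounded_operator V \<and>
     (\<exists>A. is_modulus A V \<and>
       (\<exists>E. orthonormal_basis E (\<lambda>x. x) \<and> (\<lambda>x. cinner (A x) x) summable_on E))"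

definition hyperinvariant :: "('a::complex_hilbert_space \<Rightarrow> 'a) \<Rightarrow> 'a set \<Rightarrow> bool" where
  "hyperinvariant T M \<longleftrightarrow> complex_vector.subspace M \<and> closed M \<and>
     (\<forall>S. bounded_operator S \<and> S \<circ> T = T \<circ> S \<longrightarrow> S ` M \<subseteq> M)"

end

theory Submission
  imports Defs
begin

text \<open>
  The entries of the self-commutator \<open>D = [T\<^sup>*, T]\<close> and of \<open>[R\<^sup>*, R]\<close> differ by those of a trace-class
  operator of trace zero. Write \<open>a n\<close>, \<open>b n\<close>, \<open>c n\<close> for the entries of \<open>R\<close> below, above and on the
  diagonal. The diagonal entries of \<open>[R\<^sup>*, R]\<close> telescope, so positivity of \<open>D\<close> makes \<open>D\<close>
  trace class with \<open>|a n|\<^sup>2 - |b n|\<^sup>2\<close> tending to its trace \<open>d\<close>.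

  If \<open>d = 0\<close>, then \<open>T\<close> is normal. For a suitable \<open>\<mu>\<close> and \<open>r\<close>, the vectors \<open>x\<close> for which
  \<open>norm ((T - \<mu>)\<^sup>n x)\<close> grows at most like \<open>r\<^sup>n\<close> form a nontrivial hyperinvariant subspace, which is
  visibly invariant under the commutant, so that Fuglede's theorem is not needed.

  If \<open>d > 0\<close>, then by Cauchy-Schwarz the entries of \<open>D\<close> at distance one and two from the
  diagonal are summable. This forces \<open>|a n|\<close>, \<open>|b n|\<close> and \<open>c n\<close> to converge, with
  \<open>lim |a n| > lim |b n|\<close>. Hence \<open>T - lim c n\<close> is, up to a compact operator, a perturbation of a weighted
  shift of index \<open>-1\<close>. Its adjoint has a kernel, and the closure of its range is the
  required subspace.
\<close>

section \<open>Inner product and bounded operators\<close>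

text \<open>Trace class, rather than mere compactness, is used twice. Up to adjoints, the cross
  terms between \<open>R\<close> and \<open>V\<close> come in pairs \<open>X V\<close> and
  \<open>V X\<close>, whose traces cancel; this ties the trace of \<open>D\<close> to the limit of
  \<open>|a n|^2 - |b n|^2\<close>. Moreover every diagonal of the matrix of the cross terms is
  absolutely summable. Entries that only tend to zero would still allow \<open>c n\<close> and
  \<open>|b n| / |a n|\<close> to oscillate slowly, whereas absolutely summable increments force
  limits. The commutator entry at distance one has modulus at least
  \<open>(|a n| - |b n|) * |c (n + 1) - c n|\<close>, and \<open>d > 0\<close> keeps the first
  factor away from zero. The entry at distance two is a determinant of consecutive pairs, which
  controls the ratio \<open>|b n| / |a n|\<close>; this ratio together with \<open>d\<close>
  determines both limits. Only moduli converge: the arguments of \<open>a n\<close> and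
  \<open>b n\<close> may rotate forever. The shift is therefore inverted with its actual weights
  instead of being compared with a shift of constant weight.\<close>

lemma cinner_add_right: "cinner x (y + z) = cinner x y + cinner x z"
  by (metis cinner_add_left cinner_commute complex_cnj_add)

lemma cinner_scaleC_right: "cinner x (c *\<^sub>C y) = cnj c * cinner x y"
  by (metis cinner_scaleC_left cinner_commute complex_cnj_mult)

lemma norm_scaleC: "norm (c *\<^sub>C x) = cmod c * norm (x :: 'a::complex_hilbert_space)"
proof -
  have "complex_of_real ((norm (c *\<^sub>C x))\<^sup>2) = (c * cnj c) * complex_of_real ((norm x)\<^sup>2)"
    by (metis cinner_self cinner_scaleC_left cinner_scaleC_right mult.assoc mult.commute)
  also have "\<dots> = complex_of_real ((cmod c * norm x)\<^sup>2)"
    by (simp add: complex_norm_square power_mult_distrib flip: of_real_power)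
  finally have "(norm (c *\<^sub>C x))\<^sup>2 = (cmod c * norm x)\<^sup>2"
    using of_real_eq_iff by blast
  then show ?thesis
    by (simp add: power2_eq_iff_nonneg)
qed

lemma cinner_zero_left [simp]: "cinner 0 x = 0"
  using cinner_add_left[of 0 0 x] by simp

lemma cinner_zero_right [simp]: "cinner x 0 = 0"
  using cinner_add_right[of x 0 0] by simp

lemma cinner_minus_left: "cinner (- x) y = - cinner x y"
  using cinner_add_left[of x "- x" y] by (simp add: add_eq_0_iff)

lemma cinner_minus_right: "cinner x (- y) = - cinner x y"
  using cinner_add_right[of x y "- y"] by (simp add: add_eq_0_iff)

lemma cinner_diff_left: "cinner (x - y) z = cinner x z - cinner y z"
  using cinner_add_left[of x "- y" z] by (simp add: cinner_minus_left)

lemma cinner_diff_right: "cinner x (y - z) = cinner x y - cinner x z"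
  using cinner_add_right[of x y "- z"] by (simp add: cinner_minus_right)

lemma cinner_sum_left: "cinner (sum f F) y = (\<Sum>i\<in>F. cinner (f i) y)"
  by (induction F rule: infinite_finite_induct) (auto simp: cinner_add_left)

lemma cinner_sum_right: "cinner x (sum f F) = (\<Sum>i\<in>F. cinner x (f i))"
  by (induction F rule: infinite_finite_induct) (auto simp: cinner_add_right)

lemmas cinner_algebra = cinner_add_left cinner_add_right cinner_diff_left cinner_diff_right
  cinner_scaleC_left cinner_scaleC_right

lemma norm_eq_cinner: "(norm x)\<^sup>2 = Re (cinner x x)"
  by (simp add: cinner_self)

lemma cinner_eqI:
  assumes "\<And>z. cinner x z = cinner y z"
  shows "x = y"
proof -
  have "cinner (x - y) (x - y) = 0"
    using assms by (simp add: cinner_diff_left)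
  then show ?thesis
    by (simp add: cinner_self)
qed

lemma bounded_operator_add:
  "bounded_operator T \<Longrightarrow> T (x + y) = T x + T y"
  by (simp add: bounded_operator_def linear_simps)

lemma bounded_operator_scaleC:
  "bounded_operator T \<Longrightarrow> T (c *\<^sub>C x) = c *\<^sub>C T x"
  by (simp add: bounded_operator_def)

lemma bounded_operator_diff:
  "bounded_operator T \<Longrightarrow> T (x - y) = T x - T y"
  by (simp add: bounded_operator_def linear_simps)

lemma bounded_operator_zero [simp]: "bounded_operator T \<Longrightarrow> T 0 = 0"
  by (simp add: bounded_operator_def linear_simps)

lemma bounded_operator_sum:
  "bounded_operator T \<Longrightarrow> T (sum f F) = (\<Sum>i\<in>F. T (f i))"
  by (simp add: bounded_operator_def bounded_linear.linear linear_sum)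

lemmas bounded_operator_algebra =
  bounded_operator_add bounded_operator_scaleC bounded_operator_diff

lemma bounded_operator_bound:
  assumes "bounded_operator T"
  obtains K where "K > 0" "\<And>x. norm (T x) \<le> K * norm x"
  using bounded_linear.pos_bounded assms by (metis bounded_operator_def mult.commute)

lemma bounded_operator_intro:
  assumes "\<And>x y. T (x + y) = T x + T y"
    and "\<And>c x. T (c *\<^sub>C x) = c *\<^sub>C T x"
    and "\<And>x. norm (T x) \<le> K * norm x"
  shows "bounded_operator T"
proof -
  have "bounded_linear T"
    using assms by (intro bounded_linear_intro[where K = K])
      (simp_all add: scaleR_scaleC mult.commute)
  then show ?thesis
    using assms by (simp add: bounded_operator_def)
qed

section \<open>Positive forms and the Cauchy-Schwarz inequality\<close>

text \<open>Polarization: realness of the form at \<open>x + y\<close> compares the imaginary parts,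
  realness at \<open>x + \<i> *\<^sub>C y\<close> the real parts.\<close>

lemma positive_operator_hermitian:
  assumes "positive_operator A"
  shows "cinner (A x) y = cinner x (A y)"
proof -
  have A: "bounded_operator A" and pos: "\<And>x. cinner (A x) x \<in> \<real>\<^sub>\<ge>\<^sub>0"
    using assms by (auto simp: positive_operator_def)
  have im: "Im (cinner (A z) z) = 0" for z
    using pos[of z] by (auto simp: complex_nonneg_Reals_iff)
  have "Im (cinner (A x) y + cinner (A y) x) = 0"
    using im[of "x + y"] im[of x] im[of y]
    by (simp add: bounded_operator_algebra[OF A] cinner_algebra)
  moreover have "Re (cinner (A x) y) = Re (cinner (A y) x)"
    using im[of "x + \<i> *\<^sub>C y"] im[of x] im[of y]
    by (simp add: bounded_operator_algebra[OF A] cinner_algebra)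
  ultimately have "cinner (A x) y = cnj (cinner (A y) x)"
    by (simp add: complex_eq_iff)
  then show ?thesis
    by (metis cinner_commute)
qed

text \<open>The form may vanish on nonzero vectors. Positivity at \<open>x - s c y\<close> with real
  \<open>s\<close> gives a quadratic inequality in \<open>s\<close>. For \<open>b > 0\<close> the
  minimizer is \<open>s = 1 / b\<close>; for \<open>b = 0\<close> the inequality is affine in
  \<open>s\<close>, and \<open>s = (a + 1) / |c|^2\<close> violates it unless
  \<open>c = 0\<close>.\<close>

lemma positive_operator_cauchy_schwarz:
  assumes "positive_operator A"
  shows "(cmod (cinner (A x) y))\<^sup>2 \<le> Re (cinner (A x) x) * Re (cinner (A y) y)"
proof -
  have A: "bounded_operator A" and pos: "\<And>x. cinner (A x) x \<in> \<real>\<^sub>\<ge>\<^sub>0"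
    using assms by (auto simp: positive_operator_def)
  define a b c where "a = Re (cinner (A x) x)" and "b = Re (cinner (A y) y)" and "c = cinner (A x) y"
  have c': "cinner (A y) x = cnj c"
    by (metis positive_operator_hermitian[OF assms] c_def cinner_commute)
  have ab: "a \<ge> 0" "b \<ge> 0"
    using pos[of x] pos[of y] by (auto simp: a_def b_def complex_nonneg_Reals_iff)
  have q: "0 \<le> a - 2 * s * (cmod c)\<^sup>2 + s\<^sup>2 * (cmod c)\<^sup>2 * b" for s :: real
  proof -
    let ?t = "complex_of_real s * c"
    have "0 \<le> Re (cinner (A (x - ?t *\<^sub>C y)) (x - ?t *\<^sub>C y))"
      using pos complex_nonneg_Reals_iff by blast
    also have "cinner (A (x - ?t *\<^sub>C y)) (x - ?t *\<^sub>C y) =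
        cinner (A x) x - cnj ?t * c - ?t * cnj c + ?t * cnj ?t * cinner (A y) y"
      by (simp add: bounded_operator_algebra[OF A] cinner_algebra c' algebra_simps flip: c_def)
    also have "Re \<dots> = a - 2 * s * (cmod c)\<^sup>2 + s\<^sup>2 * (cmod c)\<^sup>2 * b"
    proof -
      have 1: "cnj ?t * c = complex_of_real (s * (cmod c)\<^sup>2)" "?t * cnj c = complex_of_real (s * (cmod c)\<^sup>2)"
        by (simp_all only: complex_norm_square of_real_mult complex_cnj_mult complex_cnj_complex_of_real mult_ac)
      have 2: "?t * cnj ?t = complex_of_real (s\<^sup>2 * (cmod c)\<^sup>2)"
        by (simp only: complex_norm_square of_real_mult complex_cnj_mult
            complex_cnj_complex_of_real power2_eq_square[of s] mult_ac)
      show ?thesis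
        unfolding 1 2 by (simp add: a_def b_def flip: of_real_mult)
    qed
    finally show ?thesis .
  qed
  have "(cmod c)\<^sup>2 \<le> a * b"
  proof (cases "b = 0")
    case True
    show ?thesis
    proof (rule ccontr)
      assume "\<not> ?thesis"
      then have "(cmod c)\<^sup>2 > 0" using True by simp
      then have "(a + 1) / (cmod c)\<^sup>2 * (cmod c)\<^sup>2 = a + 1" by simp
      then show False
        using q[of "(a + 1) / (cmod c)\<^sup>2"] True ab unfolding mult.assoc by simp
    qed
  next
    case False
    then have "b > 0" using ab by simp
    then show ?thesis
      using q[of "1 / b"] by (simp add: field_simps power2_eq_square)
  qed
  then show ?thesis
    by (simp add: a_def b_def c_def)
qed

lemma positive_operator_ident: "positive_operator (\<lambda>x. x)"
  by (simp add: positive_operator_def bounded_operator_def bounded_linear_ident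
      cinner_self flip: of_real_power)

lemma cinner_cauchy_schwarz: "cmod (cinner x y) \<le> norm x * norm y"
proof -
  have "(cmod (cinner x y))\<^sup>2 \<le> (norm x * norm y)\<^sup>2"
    using positive_operator_cauchy_schwarz[OF positive_operator_ident, of x y]
    by (simp add: power_mult_distrib flip: norm_eq_cinner)
  then show ?thesis
    by (rule power2_le_imp_le) simp
qed

text \<open>Cauchy-Schwarz with \<open>y = A x\<close> bounds the fourth power of
  \<open>norm (A x)\<close> by zero. This replaces a square root of \<open>A\<close> in all later
  uses.\<close>

lemma positive_operator_null:
  assumes "positive_operator A" "cinner (A x) x = 0"
  shows "A x = 0"
  using positive_operator_cauchy_schwarz[OF assms(1), of x "A x"] assms(2) by (simp add: cinner_self)

lemma bounded_bilinear_cinner: "bounded_bilinear (cinner :: 'a::complex_hilbert_space \<Rightarrow> _)"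
proof
  show "\<exists>K. \<forall>a b :: 'a. norm (cinner a b) \<le> norm a * norm b * K"
    using cinner_cauchy_schwarz by (intro exI[of _ 1]) auto
qed (simp_all add: cinner_algebra scaleR_scaleC scaleR_conv_of_real)

lemma bounded_bilinear_scaleC: "bounded_bilinear (scaleC :: _ \<Rightarrow> 'a::complex_hilbert_space \<Rightarrow> _)"
proof
  show "\<exists>K. \<forall>a (b :: 'a). norm (a *\<^sub>C b) \<le> norm a * norm b * K"
    using norm_scaleC by (intro exI[of _ 1]) (auto simp: norm_scaleC)
qed (simp_all add: scaleC_add_left scaleC_add_right scaleR_scaleC scaleC_scaleC
    scaleR_conv_of_real mult.commute)

lemmas sums_cinner_left = bounded_linear.sums[OF bounded_bilinear.bounded_linear_left[OF bounded_bilinear_cinner]]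
lemmas sums_cinner_right = bounded_linear.sums[OF bounded_bilinear.bounded_linear_right[OF bounded_bilinear_cinner]]
lemmas sums_scaleC_right = bounded_linear.sums[OF bounded_bilinear.bounded_linear_right[OF bounded_bilinear_scaleC]]

lemma bounded_operator_sums:
  "bounded_operator T \<Longrightarrow> f sums x \<Longrightarrow> (\<lambda>n. T (f n)) sums T x"
  by (simp add: bounded_operator_def bounded_linear.sums)

lemma bounded_operator_compose:
  "bounded_operator S \<Longrightarrow> bounded_operator T \<Longrightarrow> bounded_operator (\<lambda>x. S (T x))"
  by (simp add: bounded_operator_def bounded_linear_compose)

lemma bounded_operator_plus:
  "bounded_operator S \<Longrightarrow> bounded_operator T \<Longrightarrow> bounded_operator (\<lambda>x. S x + T x)"
  by (simp add: bounded_operator_def bounded_linear_add scaleC_add_right)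

lemma bounded_operator_minus:
  "bounded_operator S \<Longrightarrow> bounded_operator T \<Longrightarrow> bounded_operator (\<lambda>x. S x - T x)"
  by (simp add: bounded_operator_def bounded_linear_sub complex_vector.scale_right_diff_distrib)

lemma bounded_operator_ident: "bounded_operator (\<lambda>x. x)"
  by (simp add: bounded_operator_def bounded_linear_ident)

lemma bounded_operator_scalar: "bounded_operator (\<lambda>x. c *\<^sub>C x)"
  by (simp add: bounded_operator_def scaleC_scaleC mult.commute
      bounded_bilinear.bounded_linear_right[OF bounded_bilinear_scaleC])

lemma bounded_operator_scaleC_comp: "bounded_operator T \<Longrightarrow> bounded_operator (\<lambda>x. c *\<^sub>C T x)"
  by (rule bounded_operator_compose[OF bounded_operator_scalar])

section \<open>Orthonormal bases and adjoints\<close>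

definition orthonormal :: "'i set \<Rightarrow> ('i \<Rightarrow> 'a::complex_hilbert_space) \<Rightarrow> bool" where
  "orthonormal I e \<longleftrightarrow> (\<forall>i\<in>I. \<forall>j\<in>I. cinner (e i) (e j) = (if i = j then 1 else 0))"

lemma orthonormalD:
  "orthonormal I e \<Longrightarrow> i \<in> I \<Longrightarrow> j \<in> I \<Longrightarrow> cinner (e i) (e j) = (if i = j then 1 else 0)"
  by (simp add: orthonormal_def)

lemma orthonormal_subset: "orthonormal I e \<Longrightarrow> J \<subseteq> I \<Longrightarrow> orthonormal J e"
  unfolding orthonormal_def by blast

lemma orthonormal_basis_orthonormal: "orthonormal_basis I e \<Longrightarrow> orthonormal I e"
  by (simp add: orthonormal_basis_def orthonormal_def)

definition eproj :: "('i \<Rightarrow> 'a::complex_hilbert_space) \<Rightarrow> 'i set \<Rightarrow> 'a \<Rightarrow> 'a" where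
  "eproj e F x = (\<Sum>i\<in>F. cinner x (e i) *\<^sub>C e i)"

lemma cinner_lincomb:
  assumes "orthonormal F e" "finite F" "j \<in> F"
  shows "cinner (\<Sum>i\<in>F. c i *\<^sub>C e i) (e j) = c j"
proof -
  have "cinner (\<Sum>i\<in>F. c i *\<^sub>C e i) (e j) = (\<Sum>i\<in>F. if i = j then c i else 0)"
    unfolding cinner_sum_left cinner_scaleC_left
    using assms by (intro sum.cong) (auto simp: orthonormalD)
  then show ?thesis
    using assms by simp
qed

lemma norm_lincomb:
  assumes "orthonormal F e" "finite F"
  shows "(norm (\<Sum>i\<in>F. c i *\<^sub>C e i))\<^sup>2 = (\<Sum>i\<in>F. (cmod (c i))\<^sup>2)"
proof -
  have "cinner (\<Sum>i\<in>F. c i *\<^sub>C e i) (\<Sum>i\<in>F. c i *\<^sub>C e i) = (\<Sum>j\<in>F. cnj (c j) * c j)"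
    by (subst cinner_sum_right) (simp add: cinner_scaleC_right cinner_lincomb[OF assms])
  also have "\<dots> = complex_of_real (\<Sum>i\<in>F. (cmod (c i))\<^sup>2)"
    unfolding of_real_sum complex_norm_square by (simp add: mult.commute)
  finally show ?thesis
    by (simp add: norm_eq_cinner)
qed

lemma norm_eproj:
  "orthonormal F e \<Longrightarrow> finite F \<Longrightarrow> (norm (eproj e F x))\<^sup>2 = (\<Sum>i\<in>F. (cmod (cinner x (e i)))\<^sup>2)"
  unfolding eproj_def by (rule norm_lincomb)

lemma cinner_eproj_residual:
  assumes "orthonormal F e" "finite F" "j \<in> F"
  shows "cinner (x - eproj e F x) (e j) = 0"
  unfolding eproj_def cinner_diff_left cinner_lincomb[OF assms] by simp

lemma eproj_residual_lincomb:
  assumes "orthonormal F e" "finite F"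
  shows "cinner (x - eproj e F x) (\<Sum>i\<in>F. c i *\<^sub>C e i) = 0"
  by (simp add: cinner_sum_right cinner_scaleC_right cinner_eproj_residual[OF assms])

lemma norm_add_orthogonal:
  assumes "cinner x y = 0"
  shows "(norm (x + y))\<^sup>2 = (norm x)\<^sup>2 + (norm y)\<^sup>2"
proof -
  have "cinner y x = 0"
    using assms by (metis cinner_commute complex_cnj_zero)
  then show ?thesis
    using assms by (simp add: norm_eq_cinner cinner_algebra)
qed

lemma norm_eproj_pythagoras:
  assumes "orthonormal F e" "finite F"
  shows "(norm x)\<^sup>2 = (norm (eproj e F x))\<^sup>2 + (norm (x - eproj e F x))\<^sup>2"
  using norm_add_orthogonal[of "x - eproj e F x" "eproj e F x"]
    eproj_residual_lincomb[OF assms, of x "\<lambda>i. cinner x (e i)"]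
  by (simp flip: eproj_def)

lemma bessel:
  assumes "orthonormal F e" "finite F"
  shows "(\<Sum>i\<in>F. (cmod (cinner x (e i)))\<^sup>2) \<le> (norm x)\<^sup>2"
  using norm_eproj_pythagoras[OF assms, of x] norm_eproj[OF assms, of x] by simp

lemma eproj_best_approximation:
  assumes "orthonormal F e" "finite F"
  shows "norm (x - eproj e F x) \<le> norm (x - (\<Sum>i\<in>F. c i *\<^sub>C e i))"
proof -
  have eq: "x - (\<Sum>i\<in>F. c i *\<^sub>C e i) =
      (x - eproj e F x) + (\<Sum>i\<in>F. (cinner x (e i) - c i) *\<^sub>C e i)"
    by (simp add: eproj_def complex_vector.scale_left_diff_distrib sum_subtractf)
  have "(norm (x - (\<Sum>i\<in>F. c i *\<^sub>C e i)))\<^sup>2 =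
      (norm (x - eproj e F x))\<^sup>2 + (norm (\<Sum>i\<in>F. (cinner x (e i) - c i) *\<^sub>C e i))\<^sup>2"
    unfolding eq by (intro norm_add_orthogonal eproj_residual_lincomb assms)
  then show ?thesis
    by (auto intro: power2_le_imp_le[OF _ norm_ge_zero])
qed

lemma eproj_residual_antimono:
  assumes "orthonormal G e" "finite G" "F \<subseteq> G"
  shows "norm (x - eproj e G x) \<le> norm (x - eproj e F x)"
proof -
  have "eproj e F x = (\<Sum>i\<in>G. (if i \<in> F then cinner x (e i) else 0) *\<^sub>C e i)"
    unfolding eproj_def using assms
    by (intro sum.mono_neutral_cong_left) auto
  then show ?thesis
    using eproj_best_approximation[OF assms(1,2)] by metis
qed

text \<open>\<open>e\<close> may repeat values on \<open>I\<close>, so one index is chosen for each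
  vector before the sum is reindexed.\<close>

lemma span_image_lincomb:
  assumes "x \<in> complex_vector.span (e ` I)"
  obtains F c where "finite F" "F \<subseteq> I" "x = (\<Sum>i\<in>F. c i *\<^sub>C e i)"
proof -
  from assms obtain t r where t: "finite t" "t \<subseteq> e ` I" "x = (\<Sum>a\<in>t. r a *\<^sub>C a)"
    unfolding complex_vector.span_explicit by auto
  obtain F where F: "F \<subseteq> I" "finite F" "t = e ` F" "inj_on e F"
    using t(1,2) subset_image_inj[of t e I] finite_imageD by metis
  have "x = (\<Sum>i\<in>F. (r \<circ> e) i *\<^sub>C e i)"
    unfolding t(3) F(3) by (simp add: sum.reindex[OF F(4)])
  then show ?thesis
    using that F by blast
qed

lemma orthonormal_basis_approximation:
  assumes e: "orthonormal_basis I e" and "\<epsilon> > 0"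
  obtains F where "finite F" "F \<subseteq> I" "norm (x - eproj e F x) < \<epsilon>"
proof -
  have "x \<in> closure (complex_vector.span (e ` I))"
    using e by (simp add: orthonormal_basis_def)
  then obtain y where y: "y \<in> complex_vector.span (e ` I)" "dist y x < \<epsilon>"
    using \<open>\<epsilon> > 0\<close> by (auto simp: closure_approachable)
  obtain F c where F: "finite F" "F \<subseteq> I" "y = (\<Sum>i\<in>F. c i *\<^sub>C e i)"
    using span_image_lincomb[OF y(1)] .
  have "orthonormal F e"
    using e F orthonormal_basis_orthonormal orthonormal_subset by blast
  from eproj_best_approximation[OF this F(1), of x c]
  have "norm (x - eproj e F x) < \<epsilon>"
    using y(2) F(3) by (simp add: dist_norm norm_minus_commute)
  with F show ?thesis
    using that by blast
qed

text \<open>The Riesz-Fischer theorem. Orthonormality alone is assumed, because weighted shifts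
  apply it to a subsequence of a basis.\<close>

lemma sums_lincomb:
  assumes f: "orthonormal UNIV (f :: nat \<Rightarrow> 'a::complex_hilbert_space)"
    and c: "summable (\<lambda>n. (cmod (c n))\<^sup>2)"
  shows "summable (\<lambda>n. c n *\<^sub>C f n)"
    and "(norm (\<Sum>n. c n *\<^sub>C f n))\<^sup>2 = (\<Sum>n. (cmod (c n))\<^sup>2)"
proof -
  have on: "orthonormal F f" for F
    using f orthonormal_subset by blast
  show s: "summable (\<lambda>n. c n *\<^sub>C f n)"
    unfolding summable_Cauchy
  proof safe
    fix \<epsilon> :: real assume "\<epsilon> > 0"
    then obtain N where N: "\<And>m n. m \<ge> N \<Longrightarrow> norm (\<Sum>i\<in>{m..<n}. (cmod (c i))\<^sup>2) < \<epsilon>\<^sup>2"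
      using c unfolding summable_Cauchy by (metis zero_less_power)
    have "norm (\<Sum>i\<in>{m..<n}. c i *\<^sub>C f i) < \<epsilon>" if "m \<ge> N" for m n
    proof (rule power2_less_imp_less)
      show "(norm (\<Sum>i\<in>{m..<n}. c i *\<^sub>C f i))\<^sup>2 < \<epsilon>\<^sup>2"
        using N[OF that, of n] by (simp add: norm_lincomb[OF on] sum_nonneg)
    qed (use \<open>\<epsilon> > 0\<close> in simp)
    then show "\<exists>N. \<forall>m\<ge>N. \<forall>n. norm (\<Sum>i\<in>{m..<n}. c i *\<^sub>C f i) < \<epsilon>"
      by blast
  qed
  have "(\<lambda>n. (norm (\<Sum>i<n. c i *\<^sub>C f i))\<^sup>2) \<longlonglongrightarrow> (norm (\<Sum>n. c n *\<^sub>C f n))\<^sup>2"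
    using summable_LIMSEQ[OF s] by (intro tendsto_intros)
  moreover have "(\<lambda>n. (norm (\<Sum>i<n. c i *\<^sub>C f i))\<^sup>2) \<longlonglongrightarrow> (\<Sum>n. (cmod (c n))\<^sup>2)"
    using summable_LIMSEQ[OF c] by (simp add: norm_lincomb[OF on])
  ultimately show "(norm (\<Sum>n. c n *\<^sub>C f n))\<^sup>2 = (\<Sum>n. (cmod (c n))\<^sup>2)"
    by (rule LIMSEQ_unique)
qed

lemma bounded_operator_eq_0_closure:
  assumes "bounded_operator S" "\<And>i. i \<in> I \<Longrightarrow> S (e i) = 0" "orthonormal_basis I e"
  shows "S x = 0"
proof -
  have "closed {x. S x = 0}"
    using assms(1) by (auto simp: bounded_operator_def intro!: closed_Collect_eq
        linear_continuous_on continuous_intros)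
  moreover have "complex_vector.span (e ` I) \<subseteq> {x. S x = 0}"
  proof
    fix x assume "x \<in> complex_vector.span (e ` I)"
    then obtain F c where "finite F" "F \<subseteq> I" "x = (\<Sum>i\<in>F. c i *\<^sub>C e i)"
      by (rule span_image_lincomb)
    then show "x \<in> {x. S x = 0}"
      using assms(1,2)
      by (auto simp: bounded_operator_sum bounded_operator_scaleC intro!: sum.neutral)
  qed
  ultimately have "closure (complex_vector.span (e ` I)) \<subseteq> {x. S x = 0}"
    by (simp add: closure_minimal)
  then show ?thesis
    using assms(3) by (auto simp: orthonormal_basis_def)
qed

lemma bounded_operator_eqI_basis:
  assumes "bounded_operator S" "bounded_operator T" "\<And>i. i \<in> I \<Longrightarrow> S (e i) = T (e i)"
    "orthonormal_basis I e"
  shows "S x = T x"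
  using bounded_operator_eq_0_closure[OF bounded_operator_minus[OF assms(1,2)], of I e x] assms by simp

section \<open>Expansions in a basis indexed by the naturals, adjoints and weighted shifts\<close>

locale hilbert_basis =
  fixes e :: "nat \<Rightarrow> 'a::complex_hilbert_space"
  assumes basis: "orthonormal_basis UNIV e"
begin

lemma on: "orthonormal F e"
  using basis orthonormal_basis_orthonormal orthonormal_subset by blast

lemma cinner_basis [simp]: "cinner (e i) (e j) = (if i = j then 1 else 0)"
  using orthonormalD[OF on[of UNIV]] by simp

lemma norm_basis [simp]: "norm (e i) = 1"
  using norm_eq_cinner[of "e i"] norm_ge_zero[of "e i"] by (simp add: power2_eq_1_iff del: norm_ge_zero)

lemma eproj_tendsto: "(\<lambda>n. eproj e {..<n} x) \<longlonglongrightarrow> x"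
proof (rule LIMSEQ_I)
  fix \<epsilon> :: real assume "\<epsilon> > 0"
  then obtain F where F: "finite F" "F \<subseteq> UNIV" "norm (x - eproj e F x) < \<epsilon>"
    by (rule orthonormal_basis_approximation[OF basis])
  obtain N where N: "F \<subseteq> {..<N}"
    using finite_nat_bounded[OF F(1)] by blast
  show "\<exists>N. \<forall>n\<ge>N. norm (eproj e {..<n} x - x) < \<epsilon>"
  proof (intro exI allI impI)
    fix n assume "N \<le> n"
    then have "F \<subseteq> {..<n}" using N by auto
    from eproj_residual_antimono[OF on _ this, of x]
    show "norm (eproj e {..<n} x - x) < \<epsilon>"
      using F(3) by (simp add: norm_minus_commute)
  qed
qed

lemma basis_expansion: "(\<lambda>n. cinner x (e n) *\<^sub>C e n) sums x"
  using eproj_tendsto[of x] by (simp add: sums_def eproj_def)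

lemma cinner_expansion: "(\<lambda>n. cinner x (e n) * cinner (e n) y) sums cinner x y"
  using sums_cinner_left[OF basis_expansion, of x y] by (simp add: cinner_scaleC_left)

lemma parseval: "(\<lambda>n. (cmod (cinner x (e n)))\<^sup>2) sums (norm x)\<^sup>2"
proof -
  have "(\<lambda>n. (norm (eproj e {..<n} x))\<^sup>2) \<longlonglongrightarrow> (norm x)\<^sup>2"
    using eproj_tendsto by (intro tendsto_intros)
  then show ?thesis
    by (simp add: sums_def norm_eproj[OF on])
qed

lemma operator_eqI:
  "bounded_operator S \<Longrightarrow> bounded_operator T \<Longrightarrow> (\<And>n. S (e n) = T (e n)) \<Longrightarrow> S x = T x"
  for S T :: "'a \<Rightarrow> 'a"
  using bounded_operator_eqI_basis[OF _ _ _ basis] by blast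

text \<open>The adjoint is assembled from its matrix, which avoids the Riesz representation theorem.\<close>

lemma adjoint_exists:
  fixes T :: "'a \<Rightarrow> 'a"
  assumes T: "bounded_operator T"
  shows "\<exists>S. \<forall>x y. cinner (S x) y = cinner x (T y)"
proof -
  obtain K where K: "K > 0" "\<And>x. norm (T x) \<le> K * norm x"
    using bounded_operator_bound[OF T] by metis
  have "\<exists>z. \<forall>y. cinner z y = cinner x (T y)" for x
  proof -
    define c where "c n = cinner x (T (e n))" for n
    have "summable (\<lambda>n. (cmod (c n))\<^sup>2)"
    proof (rule summableI_nonneg_bounded)
      fix n
      \<comment> \<open>\<open>z\<close> is a truncation of the vector sought. Testing
        \<open>T\<close> on it gives
        \<open>norm z ^ 2 = |cinner x (T z)| <= K * norm x * norm z\<close>, a bound uniform in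
        \<open>n\<close>.\<close>
      define z where "z = (\<Sum>i<n. c i *\<^sub>C e i)"
      have nz: "(norm z)\<^sup>2 = (\<Sum>i<n. (cmod (c i))\<^sup>2)"
        unfolding z_def by (rule norm_lincomb[OF on]) simp
      have "cinner x (T z) = (\<Sum>i<n. cnj (c i) * c i)"
        by (simp add: z_def bounded_operator_sum[OF T] bounded_operator_scaleC[OF T]
            cinner_sum_right cinner_scaleC_right c_def)
      also have "\<dots> = complex_of_real ((norm z)\<^sup>2)"
        unfolding nz of_real_sum complex_norm_square by (simp add: mult.commute)
      finally have "(norm z)\<^sup>2 = cmod (cinner x (T z))"
        by (simp add: norm_power)
      also have "\<dots> \<le> norm x * (K * norm z)"
        using cinner_cauchy_schwarz[of x "T z"] K(2)[of z] mult_left_mono[of "norm (T z)" "K * norm z" "norm x"]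
        by simp
      finally have "norm z * norm z \<le> (K * norm x) * norm z"
        by (simp add: power2_eq_square mult_ac)
      then have "norm z \<le> K * norm x"
        using K(1) by (cases "norm z = 0") auto
      then show "(\<Sum>i<n. (cmod (c i))\<^sup>2) \<le> (K * norm x)\<^sup>2"
        unfolding nz[symmetric] by (simp add: power_mono)
    qed simp
    then have z: "(\<lambda>n. c n *\<^sub>C e n) sums (\<Sum>n. c n *\<^sub>C e n)" (is "_ sums ?z")
      using sums_lincomb(1)[OF on] summable_sums by blast
    have "cinner ?z y = cinner x (T y)" for y
    proof -
      have "(\<lambda>n. c n * cinner (e n) y) sums cinner ?z y"
        using sums_cinner_left[OF z] by (simp add: cinner_scaleC_left)
      moreover have "(\<lambda>n. c n * cinner (e n) y) sums cinner x (T y)"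
        using sums_cinner_right[OF bounded_operator_sums[OF T basis_expansion], of x y]
        by (simp add: bounded_operator_scaleC[OF T] cinner_scaleC_right c_def mult.commute
            cinner_commute[of y])
      ultimately show ?thesis
        by (rule sums_unique2)
    qed
    then show ?thesis by blast
  qed
  then show ?thesis by metis
qed

text \<open>Resolves the definite description in \<open>cadjoint\<close>; everything later about
  adjoints goes through this identity.\<close>

lemma cinner_cadjoint_left:
  fixes T :: "'a \<Rightarrow> 'a"
  assumes "bounded_operator T"
  shows "cinner (cadjoint T x) y = cinner x (T y)"
proof -
  obtain S where S: "\<forall>x y. cinner (S x) y = cinner x (T y)"
    using adjoint_exists[OF assms] by blast
  have "cadjoint T = S"
    unfolding cadjoint_def
  proof (rule the_equality, rule S)
    fix S' assume "\<forall>x y. cinner (S' x) y = cinner x (T y)"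
    with S show "S' = S"
      by (intro ext cinner_eqI) simp
  qed
  with S show ?thesis by simp
qed

lemma cinner_cadjoint_right:
  "bounded_operator T \<Longrightarrow> cinner x (cadjoint T y) = cinner (T x) y" for T :: "'a \<Rightarrow> 'a"
  by (metis cinner_cadjoint_left cinner_commute)

lemma cadjoint_eqI:
  fixes T :: "'a \<Rightarrow> 'a"
  assumes "bounded_operator T" "\<And>x y. cinner (S x) y = cinner x (T y)"
  shows "cadjoint T = S"
  using assms by (intro ext cinner_eqI) (simp add: cinner_cadjoint_left)

lemma cadjoint_norm_le:
  fixes T :: "'a \<Rightarrow> 'a"
  assumes T: "bounded_operator T" and K: "\<And>x. norm (T x) \<le> K * norm x"
  shows "norm (cadjoint T x) \<le> K * norm x"
proof -
  have "(norm (cadjoint T x))\<^sup>2 = cmod (cinner x (T (cadjoint T x)))"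
    by (simp add: cinner_self norm_power flip: cinner_cadjoint_left[OF T])
  also have "\<dots> \<le> norm x * (K * norm (cadjoint T x))"
    by (rule order_trans[OF cinner_cauchy_schwarz]) (simp add: K mult_left_mono)
  finally have "norm (cadjoint T x) * norm (cadjoint T x) \<le> (K * norm x) * norm (cadjoint T x)"
    by (simp add: power2_eq_square mult_ac)
  moreover have "0 \<le> K * norm x"
    using K[of x] norm_ge_zero order_trans by blast
  ultimately show ?thesis
    by (cases "norm (cadjoint T x) = 0") auto
qed

lemma bounded_operator_cadjoint:
  fixes T :: "'a \<Rightarrow> 'a"
  assumes T: "bounded_operator T"
  shows "bounded_operator (cadjoint T)"
proof -
  obtain K where K: "\<And>x. norm (T x) \<le> K * norm x"
    using bounded_operator_bound[OF T] by metis
  show ?thesis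
  proof (rule bounded_operator_intro[OF _ _ cadjoint_norm_le[OF T K]])
    fix x y c
    show "cadjoint T (x + y) = cadjoint T x + cadjoint T y"
      by (rule cinner_eqI) (simp add: cinner_cadjoint_left[OF T] cinner_algebra)
    show "cadjoint T (c *\<^sub>C x) = c *\<^sub>C cadjoint T x"
      by (rule cinner_eqI) (simp add: cinner_cadjoint_left[OF T] cinner_algebra)
  qed
qed

lemma cadjoint_cadjoint: "bounded_operator T \<Longrightarrow> cadjoint (cadjoint T) = T" for T :: "'a \<Rightarrow> 'a"
  by (rule cadjoint_eqI[OF bounded_operator_cadjoint cinner_cadjoint_right[symmetric]])

text \<open>Injectivity of \<open>\<sigma>\<close> keeps the image vectors orthonormal, so the
  supremum of the weights bounds the norm. \<open>adjoint_eigenvector\<close> takes from here a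
  right inverse of its shift and two error terms.\<close>

lemma weighted_shift_exists:
  assumes \<sigma>: "inj (\<sigma> :: nat \<Rightarrow> nat)" and t: "\<And>n. cmod (t n) \<le> C"
  shows "\<exists>W. bounded_operator W \<and> (\<forall>n. W (e n) = t n *\<^sub>C e (\<sigma> n)) \<and> (\<forall>x. norm (W x) \<le> C * norm x)"
proof -
  define c where "c x n = cinner x (e n) * t n" for x n
  define W where "W x = (\<Sum>n. c x n *\<^sub>C e (\<sigma> n))" for x
  have C: "C \<ge> 0"
    using t[of 0] norm_ge_zero order_trans by blast
  have on': "orthonormal UNIV (\<lambda>n. e (\<sigma> n))"
    using \<sigma> by (simp add: orthonormal_def inj_eq)
  have le: "(cmod (c x n))\<^sup>2 \<le> C\<^sup>2 * (cmod (cinner x (e n)))\<^sup>2" for x n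
    using power_mono[OF mult_left_mono[OF t[of n], of "cmod (cinner x (e n))"], of 2]
    by (simp add: c_def norm_mult power_mult_distrib mult_ac)
  have sq: "(\<lambda>n. C\<^sup>2 * (cmod (cinner x (e n)))\<^sup>2) sums (C\<^sup>2 * (norm x)\<^sup>2)" for x
    by (intro sums_mult parseval)
  have sc: "summable (\<lambda>n. (cmod (c x n))\<^sup>2)" for x
    by (rule summable_comparison_test'[OF sums_summable[OF sq[of x]], of 0]) (simp add: le)
  have W: "(\<lambda>n. c x n *\<^sub>C e (\<sigma> n)) sums W x" for x
    unfolding W_def by (rule summable_sums[OF sums_lincomb(1)[OF on' sc]])
  have norm: "norm (W x) \<le> C * norm x" for x
  proof (rule power2_le_imp_le)
    show "(norm (W x))\<^sup>2 \<le> (C * norm x)\<^sup>2"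
      unfolding W_def sums_lincomb(2)[OF on' sc] power_mult_distrib
      using suminf_le[OF le sc[of x] sums_summable[OF sq[of x]]] sums_unique[OF sq[of x]] by simp
  qed (simp add: C)
  have "bounded_operator W"
  proof (rule bounded_operator_intro[OF _ _ norm])
    fix x y d
    show "W (x + y) = W x + W y"
      using sums_unique2[OF W[of "x + y"]] sums_add[OF W[of x] W[of y]]
      by (simp add: c_def cinner_add_left distrib_right scaleC_add_left)
    show "W (d *\<^sub>C x) = d *\<^sub>C W x"
      using sums_unique2[OF W[of "d *\<^sub>C x"]] sums_scaleC_right[OF W[of x], of d]
      by (simp add: c_def cinner_scaleC_left scaleC_scaleC mult.assoc)
  qed
  moreover have "W (e n) = t n *\<^sub>C e (\<sigma> n)" for n
  proof -
    have "(\<lambda>m. c (e n) m *\<^sub>C e (\<sigma> m)) = (\<lambda>m. if m = n then t m *\<^sub>C e (\<sigma> m) else 0)"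
      by (auto simp: c_def)
    then show ?thesis
      using sums_unique2[OF W[of "e n"]] sums_single[of n "\<lambda>m. t m *\<^sub>C e (\<sigma> m)"] by metis
  qed
  ultimately show ?thesis
    using norm by blast
qed

end

section \<open>Trace-class operators as nuclear series\<close>

text \<open>Gram-Schmidt for the possibly degenerate form \<open>cinner (A x) y\<close>. A residual
  of length zero in this form yields the vector 0, which keeps the indices aligned with those of
  \<open>x\<close>.\<close>

fun form_gram_schmidt :: "('a::complex_hilbert_space \<Rightarrow> 'a) \<Rightarrow> (nat \<Rightarrow> 'a) \<Rightarrow> nat \<Rightarrow> 'a" where
  "form_gram_schmidt A x n =
    (let z = x n - (\<Sum>k<n. cinner (A (x n)) (form_gram_schmidt A x k) *\<^sub>C form_gram_schmidt A x k);
         q = Re (cinner (A z) z)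
     in if q = 0 then 0 else complex_of_real (1 / sqrt q) *\<^sub>C z)"

declare form_gram_schmidt.simps [simp del]

definition form_residual ::
  "('a::complex_hilbert_space \<Rightarrow> 'a) \<Rightarrow> (nat \<Rightarrow> 'a) \<Rightarrow> nat \<Rightarrow> 'a \<Rightarrow> 'a" where
  "form_residual A y n x = x - (\<Sum>k<n. cinner (A x) (y k) *\<^sub>C y k)"

text \<open>The test \<open>y j \<noteq> 0\<close> accommodates the zero vectors that Gram-Schmidt
  inserts; every other vector has length one in the form.\<close>

definition form_orthonormal ::
  "('a::complex_hilbert_space \<Rightarrow> 'a) \<Rightarrow> (nat \<Rightarrow> 'a) \<Rightarrow> nat \<Rightarrow> bool" where
  "form_orthonormal A y n \<longleftrightarrow>
     (\<forall>j<n. \<forall>k<n. cinner (A (y j)) (y k) = (if j = k \<and> y j \<noteq> 0 then 1 else 0))"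

lemma form_gram_schmidt_residual:
  fixes A :: "'a::complex_hilbert_space \<Rightarrow> 'a" and x :: "nat \<Rightarrow> 'a" and n :: nat
  defines "z \<equiv> form_residual A (form_gram_schmidt A x) n (x n)"
  shows "form_gram_schmidt A x n = (if Re (cinner (A z) z) = 0 then 0
    else complex_of_real (1 / sqrt (Re (cinner (A z) z))) *\<^sub>C z)"
  unfolding z_def form_residual_def
  by (subst form_gram_schmidt.simps) (simp only: Let_def)

lemma form_residual_orthogonal:
  assumes A: "bounded_operator A" and y: "form_orthonormal A y n" and "j < n"
  shows "cinner (A (form_residual A y n x)) (y j) = 0"
proof -
  have "(\<Sum>k<n. cinner (A x) (y k) * cinner (A (y k)) (y j)) =
      (\<Sum>k<n. if k = j then cinner (A x) (y j) else 0)"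
    using y \<open>j < n\<close> by (intro sum.cong) (auto simp: form_orthonormal_def)
  then show ?thesis
    using \<open>j < n\<close> by (simp add: form_residual_def bounded_operator_algebra[OF A]
        bounded_operator_sum[OF A] cinner_algebra cinner_sum_left)
qed

lemma form_residual_self:
  assumes A: "positive_operator A" and y: "form_orthonormal A y n"
  shows "cinner (A (form_residual A y n x)) (form_residual A y n x) =
    cinner (A x) x - complex_of_real (\<Sum>k<n. (cmod (cinner (A x) (y k)))\<^sup>2)"
proof -
  have bA: "bounded_operator A"
    using A by (simp add: positive_operator_def)
  let ?z = "form_residual A y n x"
  have "cinner (A ?z) ?z = cinner (A ?z) (x - (\<Sum>k<n. cinner (A x) (y k) *\<^sub>C y k))"
    by (simp add: form_residual_def)
  also have "\<dots> = cinner (A ?z) x"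
    by (simp add: cinner_diff_right cinner_sum_right cinner_scaleC_right
        form_residual_orthogonal[OF bA y])
  also have "\<dots> = cinner (A x) x - (\<Sum>k<n. cinner (A x) (y k) * cinner (A (y k)) x)"
    by (simp add: form_residual_def bounded_operator_algebra[OF bA]
        bounded_operator_sum[OF bA] cinner_algebra cinner_sum_left)
  also have "(\<Sum>k<n. cinner (A x) (y k) * cinner (A (y k)) x) =
      (\<Sum>k<n. cinner (A x) (y k) * cnj (cinner (A x) (y k)))"
    by (metis positive_operator_hermitian[OF A] cinner_commute)
  also have "\<dots> = complex_of_real (\<Sum>k<n. (cmod (cinner (A x) (y k)))\<^sup>2)"
    by (simp only: of_real_sum complex_norm_square)
  finally show ?thesis .
qed

lemma form_bessel:
  assumes A: "positive_operator A" and y: "form_orthonormal A y n"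
  shows "(\<Sum>k<n. (cmod (cinner (A x) (y k)))\<^sup>2) \<le> Re (cinner (A x) x)"
proof -
  have "cinner (A (form_residual A y n x)) (form_residual A y n x) \<in> \<real>\<^sub>\<ge>\<^sub>0"
    using A by (simp add: positive_operator_def)
  then show ?thesis
    unfolding form_residual_self[OF A y] complex_nonneg_Reals_iff by simp
qed

lemma form_gram_schmidt_orthonormal:
  assumes A: "positive_operator A"
  shows "form_orthonormal A (form_gram_schmidt A x) n"
proof (induction n)
  case 0
  then show ?case by (simp add: form_orthonormal_def)
next
  case (Suc n)
  have bA: "bounded_operator A"
    using A by (simp add: positive_operator_def)
  define y where "y = form_gram_schmidt A x"
  define z where "z = form_residual A y n (x n)"
  define q where "q = Re (cinner (A z) z)"
  have pos: "cinner (A z) z \<in> \<real>\<^sub>\<ge>\<^sub>0"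
    using A by (simp add: positive_operator_def)
  have q: "cinner (A z) z = complex_of_real q" "q \<ge> 0"
    using pos by (auto simp: q_def complex_nonneg_Reals_iff complex_eq_iff)
  have y: "y n = (if q = 0 then 0 else complex_of_real (1 / sqrt q) *\<^sub>C z)"
    unfolding y_def q_def z_def by (rule form_gram_schmidt_residual)
  have on: "form_orthonormal A y n"
    using Suc by (simp add: y_def)
  have o: "cinner (A (y n)) (y j) = 0" if "j < n" for j
    using form_residual_orthogonal[OF bA on that, of "x n"]
    by (simp add: y bounded_operator_scaleC[OF bA] bounded_operator_zero[OF bA]
        cinner_scaleC_left flip: z_def)
  have o': "cinner (A (y j)) (y n) = 0" if "j < n" for j
    using o[OF that] by (metis positive_operator_hermitian[OF A] cinner_commute complex_cnj_zero)
  have "cinner (A (y n)) (y n) = 1" if "y n \<noteq> 0"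
  proof -
    have "q > 0"
      using that q(2) y by (auto split: if_splits)
    have "1 / sqrt q * (1 / sqrt q * q) = 1"
      using \<open>q > 0\<close> by (simp add: field_simps)
    then have "complex_of_real (1 / sqrt q) * (complex_of_real (1 / sqrt q) * complex_of_real q) = 1"
      by (metis of_real_1 of_real_mult)
    then show ?thesis
      using \<open>q > 0\<close> q(1)
      by (simp add: y bounded_operator_scaleC[OF bA] cinner_scaleC_left cinner_scaleC_right
          del: of_real_divide)
  qed
  then show ?case
    using on o o' bounded_operator_zero[OF bA]
    by (auto simp: form_orthonormal_def less_Suc_eq simp flip: y_def)
qed

text \<open>The expansion is exact only modulo the kernel of \<open>A\<close>: the remainder is zero
  or a null vector of the form, and \<open>positive_operator_null\<close> shows that
  \<open>A\<close> kills the latter.\<close>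

lemma form_gram_schmidt_expansion:
  fixes A :: "'a::complex_hilbert_space \<Rightarrow> 'a" and x :: "nat \<Rightarrow> 'a"
  assumes A: "positive_operator A"
  defines "y \<equiv> form_gram_schmidt A x"
  shows "A (x n - (\<Sum>k<Suc n. cinner (A (x n)) (y k) *\<^sub>C y k)) = 0"
proof -
  have bA: "bounded_operator A"
    using A by (simp add: positive_operator_def)
  define z where "z = form_residual A y n (x n)"
  define q where "q = Re (cinner (A z) z)"
  have pos: "cinner (A z) z \<in> \<real>\<^sub>\<ge>\<^sub>0"
    using A by (simp add: positive_operator_def)
  have q: "cinner (A z) z = complex_of_real q" "q \<ge> 0"
    using pos by (auto simp: q_def complex_nonneg_Reals_iff complex_eq_iff)
  have y: "y n = (if q = 0 then 0 else complex_of_real (1 / sqrt q) *\<^sub>C z)"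
    unfolding y_def q_def z_def by (rule form_gram_schmidt_residual)
  have on: "form_orthonormal A y k" for k
    unfolding y_def by (rule form_gram_schmidt_orthonormal[OF A])
  have eq: "x n - (\<Sum>k<Suc n. cinner (A (x n)) (y k) *\<^sub>C y k) = z - cinner (A (x n)) (y n) *\<^sub>C y n"
    by (simp add: z_def form_residual_def)
  show ?thesis
  proof (cases "q = 0")
    case True
    then show ?thesis
      using positive_operator_null[OF A, of z] q unfolding eq by (simp add: y)
  next
    case False
    then have "q > 0" using q(2) by simp
    have x: "x n = z + (\<Sum>k<n. cinner (A (x n)) (y k) *\<^sub>C y k)"
      by (simp add: z_def form_residual_def)
    have *: "cinner (A (y k)) (y n) = 0" if "k < n" for k
      using on[of "Suc n"] that by (simp add: form_orthonormal_def)
    have "cinner (A (x n)) (y n) = cinner (A z) (y n)"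
      by (subst x) (simp add: bounded_operator_algebra[OF bA] bounded_operator_sum[OF bA]
          cinner_algebra cinner_sum_left *)
    also have "\<dots> = complex_of_real (1 / sqrt q * q)"
      using False by (simp add: y cinner_scaleC_right q(1))
    also have "1 / sqrt q * q = sqrt q"
      using \<open>q > 0\<close> by (simp add: real_div_sqrt)
    finally have "cinner (A (x n)) (y n) *\<^sub>C y n = (complex_of_real (sqrt q) * complex_of_real (1 / sqrt q)) *\<^sub>C z"
      using False by (simp only: y scaleC_scaleC if_False)
    also have "\<dots> = z"
      using \<open>q > 0\<close> by simp
    finally show ?thesis
      unfolding eq using bA by simp
  qed
qed

text \<open>Triangularity of the Cholesky factor: \<open>A (x n)\<close> is a combination of
  \<open>A (y k)\<close> with \<open>k <= n\<close>, all orthogonal to \<open>y m\<close>. It turns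
  the series for \<open>V (e n)\<close> into a finite sum.\<close>

lemma form_gram_schmidt_later:
  assumes A: "positive_operator A" and "n < m"
  shows "cinner (A (x n)) (form_gram_schmidt A x m) = 0"
proof -
  have bA: "bounded_operator A"
    using A by (simp add: positive_operator_def)
  let ?y = "form_gram_schmidt A x"
  have "cinner (A (?y k)) (?y m) = 0" if "k < Suc n" for k
    using form_gram_schmidt_orthonormal[OF A, of x "Suc m"] that \<open>n < m\<close>
    by (simp add: form_orthonormal_def)
  moreover have "A (x n) = A (\<Sum>k<Suc n. cinner (A (x n)) (?y k) *\<^sub>C ?y k)"
    using form_gram_schmidt_expansion[OF A, of x n] unfolding bounded_operator_diff[OF bA] by simp
  ultimately have "cinner (A (\<Sum>k<Suc n. cinner (A (x n)) (?y k) *\<^sub>C ?y k)) (?y m) = 0"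
    unfolding bounded_operator_sum[OF bA] bounded_operator_scaleC[OF bA] cinner_sum_left cinner_scaleC_left
    by (intro sum.neutral) auto
  then show ?thesis
    using \<open>A (x n) = _\<close> by metis
qed

section \<open>Absolutely convergent series of rank-one operators\<close>

text \<open>The form in which the trace-class hypothesis is used. The vectors are parameters of the
  predicate because products and adjoints act on them explicitly and the trace is computed from
  them.\<close>

definition nuclear_rep ::
  "('a::complex_hilbert_space \<Rightarrow> 'a) \<Rightarrow> (nat \<Rightarrow> 'a) \<Rightarrow> (nat \<Rightarrow> 'a) \<Rightarrow> bool" where
  "nuclear_rep W u v \<longleftrightarrow> summable (\<lambda>k. norm (u k) * norm (v k)) \<and>
     (\<forall>x. (\<lambda>k. cinner x (u k) *\<^sub>C v k) sums W x)"

lemma norm_rank_one_le: "norm (cinner x u *\<^sub>C v) \<le> norm x * (norm u * norm v)"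
  using mult_right_mono[OF cinner_cauchy_schwarz[of x u], of "norm v"]
  by (simp add: norm_scaleC mult.assoc)

lemma nuclear_series:
  fixes u v :: "nat \<Rightarrow> 'a::complex_hilbert_space"
  assumes s: "summable (\<lambda>k. norm (u k) * norm (v k))"
  defines "W \<equiv> \<lambda>x. \<Sum>k. cinner x (u k) *\<^sub>C v k"
  shows "bounded_operator W" "nuclear_rep W u v"
proof -
  have sn: "summable (\<lambda>k. norm (cinner x (u k) *\<^sub>C v k))" for x
    by (rule summable_comparison_test'[OF summable_mult[OF s, of "norm x"], of 0])
      (simp add: norm_rank_one_le)
  have W: "(\<lambda>k. cinner x (u k) *\<^sub>C v k) sums W x" for x
    unfolding W_def by (rule summable_sums[OF summable_norm_cancel[OF sn]])
  have norm: "norm (W x) \<le> (\<Sum>k. norm (u k) * norm (v k)) * norm x" for x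
  proof -
    have "norm (W x) \<le> (\<Sum>k. norm (cinner x (u k) *\<^sub>C v k))"
      unfolding W_def by (rule summable_norm[OF sn])
    also have "\<dots> \<le> (\<Sum>k. norm x * (norm (u k) * norm (v k)))"
      by (rule suminf_le[OF norm_rank_one_le sn summable_mult[OF s]])
    finally show ?thesis
      by (simp add: suminf_mult[OF s] mult.commute)
  qed
  show "nuclear_rep W u v"
    using s W by (simp add: nuclear_rep_def)
  show "bounded_operator W"
  proof (rule bounded_operator_intro[OF _ _ norm])
    fix x y d
    show "W (x + y) = W x + W y"
      using sums_unique2[OF W[of "x + y"]] sums_add[OF W[of x] W[of y]]
      by (simp add: cinner_add_left scaleC_add_left)
    show "W (d *\<^sub>C x) = d *\<^sub>C W x"
      using sums_unique2[OF W[of "d *\<^sub>C x"]] sums_scaleC_right[OF W[of x], of d]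
      by (simp add: cinner_scaleC_left scaleC_scaleC)
  qed
qed

text \<open>A Parseval identity summed over \<open>k\<close>, for a basis \<open>E\<close> that is a
  bare set without enumeration. One finite \<open>G\<close> approximates
  \<open>w 0, ..., w (n - 1)\<close> at once, each up to \<open>\<delta>\<close>, and
  \<open>\<delta>\<close> is chosen so that the total error \<open>n * \<delta>^2\<close> stays
  below \<open>\<epsilon>\<close>.\<close>

lemma orthonormal_basis_sum_bound:
  fixes w :: "nat \<Rightarrow> 'a::complex_hilbert_space"
  assumes E: "orthonormal_basis E (\<lambda>x. x)"
    and B: "\<And>F. finite F \<Longrightarrow> F \<subseteq> E \<Longrightarrow> (\<Sum>x\<in>F. \<Sum>k<n. (cmod (cinner (w k) x))\<^sup>2) \<le> B"
  shows "(\<Sum>k<n. (norm (w k))\<^sup>2) \<le> B"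
proof (rule field_le_epsilon)
  fix \<epsilon> :: real assume "\<epsilon> > 0"
  define \<delta> where "\<delta> = sqrt (\<epsilon> / (real n + 1))"
  have \<delta>: "\<delta> > 0" "\<delta>\<^sup>2 = \<epsilon> / (real n + 1)"
    using \<open>\<epsilon> > 0\<close> by (auto simp: \<delta>_def)
  have "\<exists>F. finite F \<and> F \<subseteq> E \<and> norm (w k - eproj (\<lambda>x. x) F (w k)) < \<delta>" for k
    using orthonormal_basis_approximation[OF E \<delta>(1)] by metis
  then obtain F where F: "\<And>k. finite (F k)" "\<And>k. F k \<subseteq> E"
    "\<And>k. norm (w k - eproj (\<lambda>x. x) (F k) (w k)) < \<delta>"
    by metis
  define G where "G = (\<Union>k<n. F k)"
  have G: "finite G" "G \<subseteq> E"
    using F by (auto simp: G_def)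
  have onG: "orthonormal G (\<lambda>x. x)"
    using orthonormal_subset[OF orthonormal_basis_orthonormal[OF E] G(2)] .
  have "(norm (w k))\<^sup>2 \<le> (\<Sum>x\<in>G. (cmod (cinner (w k) x))\<^sup>2) + \<delta>\<^sup>2" if "k < n" for k
  proof -
    have "F k \<subseteq> G" using that by (auto simp: G_def)
    then have "norm (w k - eproj (\<lambda>x. x) G (w k)) \<le> \<delta>"
      using eproj_residual_antimono[OF onG G(1)] F(3)[of k] less_imp_le order_trans by blast
    then have "(norm (w k - eproj (\<lambda>x. x) G (w k)))\<^sup>2 \<le> \<delta>\<^sup>2"
      by (simp add: power_mono)
    then show ?thesis
      using norm_eproj_pythagoras[OF onG G(1), of "w k"] norm_eproj[OF onG G(1), of "w k"] by simp
  qed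
  then have "(\<Sum>k<n. (norm (w k))\<^sup>2) \<le> (\<Sum>k<n. (\<Sum>x\<in>G. (cmod (cinner (w k) x))\<^sup>2) + \<delta>\<^sup>2)"
    by (intro sum_mono) simp
  also have "\<dots> = (\<Sum>x\<in>G. \<Sum>k<n. (cmod (cinner (w k) x))\<^sup>2) + real n * \<delta>\<^sup>2"
    by (simp add: sum.distrib sum.swap[of _ G])
  also have "\<dots> \<le> B + \<epsilon>"
  proof (rule add_mono[OF B[OF G]])
    show "real n * \<delta>\<^sup>2 \<le> \<epsilon>"
      using \<open>\<epsilon> > 0\<close> by (simp add: \<delta>(2) field_simps)
  qed
  finally show "(\<Sum>k<n. (norm (w k))\<^sup>2) \<le> B + \<epsilon>" .
qed

context hilbert_basis
begin

text \<open>
  A Cholesky decomposition of \<open>|V|\<close> replaces the spectral theorem for compact operators. Since the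
  vectors \<open>w k\<close> lie in the range of \<open>|V|\<close>, on which \<open>V\<close> acts isometrically, the decomposition
  transfers to \<open>V\<close> without polar decomposition.
\<close>

lemma trace_class_nuclear:
  fixes V :: "'a \<Rightarrow> 'a"
  assumes "trace_class V"
  obtains u v where "nuclear_rep V u v"
proof -
  have V: "bounded_operator V"
    using assms by (simp add: trace_class_def)
  obtain A E where "is_modulus A V" and E: "orthonormal_basis E (\<lambda>x. x)"
    and sum: "(\<lambda>x. cinner (A x) x) summable_on E"
    using assms by (auto simp: trace_class_def)
  then have A: "positive_operator A" and AA: "A (A x) = cadjoint V (V x)" for x
    by (auto simp: is_modulus_def fun_eq_iff)
  have bA: "bounded_operator A"
    using A by (simp add: positive_operator_def)
  have normV: "norm (V x) = norm (A x)" for x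
  proof -
    have "cinner (V x) (V x) = cinner (A x) (A x)"
      by (metis AA cinner_cadjoint_left[OF V] positive_operator_hermitian[OF A])
    then have "(norm (V x))\<^sup>2 = (norm (A x))\<^sup>2"
      by (simp add: norm_eq_cinner)
    then show ?thesis by simp
  qed
  have nonneg: "0 \<le> Re (cinner (A x) x)" for x
    using A by (simp add: positive_operator_def complex_nonneg_Reals_iff)
  define y where "y = form_gram_schmidt A e"
  define w where "w k = A (y k)" for k
  have on: "form_orthonormal A y n" for n
    unfolding y_def by (rule form_gram_schmidt_orthonormal[OF A])
  have wx: "cinner x (w k) = cinner (A x) (y k)" for x k
    by (simp add: w_def positive_operator_hermitian[OF A])
  \<comment> \<open>The trace of \<open>|V|\<close> in the basis \<open>E\<close>. For each
    \<open>x\<close> in \<open>E\<close>, Bessel's inequality for the form bounds the sum over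
    \<open>k\<close> of \<open>|cinner (w k) x|^2\<close> by the diagonal entry at \<open>x\<close>,
    so \<open>B\<close> bounds the sum of \<open>norm (w k) ^ 2\<close>.\<close>
  define B where "B = (\<Sum>\<^sub>\<infinity>x\<in>E. Re (cinner (A x) x))"
  have "(\<Sum>k<n. (norm (w k))\<^sup>2) \<le> B" for n
  proof (rule orthonormal_basis_sum_bound[OF E])
    fix F assume F: "finite F" "F \<subseteq> E"
    have "(\<Sum>x\<in>F. \<Sum>k<n. (cmod (cinner (w k) x))\<^sup>2) \<le> (\<Sum>x\<in>F. Re (cinner (A x) x))"
    proof (rule sum_mono)
      fix x
      have "cmod (cinner (w k) x) = cmod (cinner (A x) (y k))" for k
        by (metis wx cinner_commute complex_mod_cnj)
      then show "(\<Sum>k<n. (cmod (cinner (w k) x))\<^sup>2) \<le> Re (cinner (A x) x)"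
        using form_bessel[OF A on, of x n] by simp
    qed
    also have "\<dots> \<le> B"
      unfolding B_def using F nonneg summable_on_Re[OF sum] by (intro finite_sum_le_infsum) auto
    finally show "(\<Sum>x\<in>F. \<Sum>k<n. (cmod (cinner (w k) x))\<^sup>2) \<le> B" .
  qed
  then have "summable (\<lambda>k. (norm (w k))\<^sup>2)"
    by (intro summableI_nonneg_bounded) auto
  then have s: "summable (\<lambda>k. norm (w k) * norm (V (y k)))"
    by (simp add: normV w_def power2_eq_square)
  define W where "W x = (\<Sum>k. cinner x (w k) *\<^sub>C V (y k))" for x
  have W: "bounded_operator W" "nuclear_rep W w (\<lambda>k. V (y k))"
    using nuclear_series[OF s] unfolding W_def by auto
  have We: "W (e n) = V (e n)" for n
  proof -
    \<comment> \<open>By \<open>normV\<close> the kernels of \<open>A\<close> and \<open>V\<close>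
      agree, so the expansion of \<open>e n\<close> modulo the kernel of \<open>A\<close> may be
      inserted into \<open>V\<close>.\<close>
    have "V (e n - (\<Sum>k<Suc n. cinner (A (e n)) (y k) *\<^sub>C y k)) = 0"
      using normV form_gram_schmidt_expansion[OF A, of e n] by (metis norm_eq_zero y_def)
    then have "V (e n) = (\<Sum>k<Suc n. cinner (e n) (w k) *\<^sub>C V (y k))"
      unfolding bounded_operator_diff[OF V] bounded_operator_sum[OF V] bounded_operator_scaleC[OF V] wx
      by simp
    moreover have "(\<lambda>k. cinner (e n) (w k) *\<^sub>C V (y k)) sums (\<Sum>k<Suc n. cinner (e n) (w k) *\<^sub>C V (y k))"
      by (rule sums_finite) (auto simp: wx y_def form_gram_schmidt_later[OF A])
    ultimately show ?thesis
      using W(2) sums_unique2 unfolding nuclear_rep_def by metis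
  qed
  have "W = V"
    using operator_eqI[OF W(1) V We] by (rule ext)
  with W(2) show ?thesis
    by (simp add: that)
qed

end

lemma tannery_sequence:
  fixes a :: "nat \<Rightarrow> nat \<Rightarrow> 'b :: {real_normed_algebra, banach}"
  assumes "\<And>k. (\<lambda>n. a k n) \<longlonglongrightarrow> b k" "\<And>k n. norm (a k n) \<le> M k" "summable M"
  shows "(\<lambda>n. \<Sum>k. a k n) \<longlonglongrightarrow> (\<Sum>k. b k)"
proof -
  have "\<forall>\<^sub>F (k, n) in sequentially \<times>\<^sub>F sequentially. norm (a k n) \<le> M k"
    using assms(2) by (intro always_eventually) auto
  from tannerys_theorem[OF assms(1) this assms(3)] show ?thesis
    by simp
qed

lemma nuclear_rep_summable: "nuclear_rep W u v \<Longrightarrow> summable (\<lambda>k. norm (u k) * norm (v k))"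
  by (simp add: nuclear_rep_def)

lemma nuclear_rep_sums: "nuclear_rep W u v \<Longrightarrow> (\<lambda>k. cinner x (u k) *\<^sub>C v k) sums W x"
  by (simp add: nuclear_rep_def)

lemma nuclear_rep_norm_le:
  assumes W: "nuclear_rep W u v"
  shows "norm (W x) \<le> norm x * (\<Sum>k. norm (u k) * norm (v k))"
proof -
  note s = nuclear_rep_summable[OF W]
  have sn: "summable (\<lambda>k. norm (cinner x (u k) *\<^sub>C v k))"
    by (rule summable_comparison_test'[OF summable_mult[OF s, of "norm x"], of 0])
      (simp add: norm_rank_one_le)
  have "norm (W x) \<le> (\<Sum>k. norm (cinner x (u k) *\<^sub>C v k))"
    using summable_norm[OF sn] sums_unique[OF nuclear_rep_sums[OF W, of x]] by simp
  also have "\<dots> \<le> (\<Sum>k. norm x * (norm (u k) * norm (v k)))"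
    by (rule suminf_le[OF norm_rank_one_le sn summable_mult[OF s]])
  finally show ?thesis
    by (simp add: suminf_mult[OF s])
qed

lemma nuclear_rep_cinner:
  assumes "nuclear_rep W u v"
  shows "(\<lambda>k. cinner x (u k) * cinner (v k) y) sums cinner (W x) y"
  using sums_cinner_left[OF nuclear_rep_sums[OF assms], of x y] by (simp add: cinner_scaleC_left)

lemma nuclear_rep_left:
  assumes A: "bounded_operator A" and W: "nuclear_rep W u v"
  shows "nuclear_rep (\<lambda>x. A (W x)) u (\<lambda>k. A (v k))"
  unfolding nuclear_rep_def
proof (intro conjI allI)
  obtain K where K: "\<And>x. norm (A x) \<le> K * norm x"
    using bounded_operator_bound[OF A] by metis
  show "summable (\<lambda>k. norm (u k) * norm (A (v k)))"
  proof (rule summable_comparison_test'[OF summable_mult[OF nuclear_rep_summable[OF W], of K], of 0])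
    fix k
    show "norm (norm (u k) * norm (A (v k))) \<le> K * (norm (u k) * norm (v k))"
      using mult_left_mono[OF K[of "v k"], of "norm (u k)"] by (simp add: mult_ac)
  qed
  show "(\<lambda>k. cinner x (u k) *\<^sub>C A (v k)) sums A (W x)" for x
    using bounded_operator_sums[OF A nuclear_rep_sums[OF W, of x]]
    by (simp add: bounded_operator_scaleC[OF A])
qed

context hilbert_basis
begin

lemma nuclear_rep_right:
  fixes A W :: "'a \<Rightarrow> 'a"
  assumes A: "bounded_operator A" and W: "nuclear_rep W u v"
  shows "nuclear_rep (\<lambda>x. W (A x)) (\<lambda>k. cadjoint A (u k)) v"
  unfolding nuclear_rep_def
proof (intro conjI allI)
  obtain K where K: "\<And>x. norm (cadjoint A x) \<le> K * norm x"
    using bounded_operator_bound[OF bounded_operator_cadjoint[OF A]] by metis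
  show "summable (\<lambda>k. norm (cadjoint A (u k)) * norm (v k))"
  proof (rule summable_comparison_test'[OF summable_mult[OF nuclear_rep_summable[OF W], of K], of 0])
    fix k
    show "norm (norm (cadjoint A (u k)) * norm (v k)) \<le> K * (norm (u k) * norm (v k))"
      using mult_right_mono[OF K[of "u k"], of "norm (v k)"] by (simp add: mult_ac)
  qed
  show "(\<lambda>k. cinner x (cadjoint A (u k)) *\<^sub>C v k) sums W (A x)" for x
    using nuclear_rep_sums[OF W, of "A x"] by (simp add: cinner_cadjoint_right[OF A])
qed

lemma nuclear_rep_cadjoint:
  fixes W :: "'a \<Rightarrow> 'a"
  assumes bW: "bounded_operator W" and W: "nuclear_rep W u v"
  shows "nuclear_rep (cadjoint W) v u"
proof -
  have s: "summable (\<lambda>k. norm (v k) * norm (u k))"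
    using nuclear_rep_summable[OF W] by (simp add: mult.commute)
  define S where "S x = (\<Sum>k. cinner x (v k) *\<^sub>C u k)" for x
  have S: "nuclear_rep S v u"
    using nuclear_series[OF s] by (simp add: S_def[abs_def])
  have "cinner (S x) y = cinner x (W y)" for x y
  proof -
    have "(\<lambda>k. cinner x (v k) * cinner (u k) y) sums cinner x (W y)"
      using sums_cinner_right[OF nuclear_rep_sums[OF W, of y], of x]
      by (simp add: cinner_scaleC_right mult.commute cinner_commute[of y])
    with nuclear_rep_cinner[OF S, of x y] show ?thesis
      by (rule sums_unique2)
  qed
  then have "cadjoint W = S"
    by (rule cadjoint_eqI[OF bW])
  with S show ?thesis by simp
qed

section \<open>Diagonals, trace and tails of nuclear operators\<close>

text \<open>Cauchy-Schwarz followed by Bessel. The bound is uniform in \<open>N\<close> and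
  \<open>j\<close>, so it dominates the partial sums along every diagonal.\<close>

lemma sum_coefficients_le:
  "(\<Sum>n<N. cmod (cinner (e n) x) * cmod (cinner y (e (n + j)))) \<le> norm x * norm y"
proof (rule power2_le_imp_le)
  have on': "orthonormal F (\<lambda>n. e (n + j))" for F
    by (simp add: orthonormal_def)
  have "(\<Sum>n<N. cmod (cinner (e n) x) * cmod (cinner y (e (n + j))))\<^sup>2
      \<le> (\<Sum>n<N. (cmod (cinner (e n) x))\<^sup>2) * (\<Sum>n<N. (cmod (cinner y (e (n + j))))\<^sup>2)"
    by (rule Cauchy_Schwarz_ineq_sum)
  also have "\<dots> \<le> (norm x)\<^sup>2 * (norm y)\<^sup>2"
  proof (rule mult_mono)
    have "cmod (cinner (e n) x) = cmod (cinner x (e n))" for n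
      by (metis cinner_commute complex_mod_cnj)
    then show "(\<Sum>n<N. (cmod (cinner (e n) x))\<^sup>2) \<le> (norm x)\<^sup>2"
      using bessel[OF on, of "{..<N}" x] by simp
    show "(\<Sum>n<N. (cmod (cinner y (e (n + j))))\<^sup>2) \<le> (norm y)\<^sup>2"
      using bessel[OF on', of "{..<N}" y] by simp
  qed (auto intro: sum_nonneg)
  finally show "(\<Sum>n<N. cmod (cinner (e n) x) * cmod (cinner y (e (n + j))))\<^sup>2 \<le> (norm x * norm y)\<^sup>2"
    by (simp add: power_mult_distrib)
qed simp

text \<open>After exchanging the sums over \<open>n\<close> and \<open>k\<close>, each rank-one term
  contributes at most \<open>norm (u k) * norm (v k)\<close> to a diagonal.\<close>

lemma nuclear_diagonal_summable:
  assumes W: "nuclear_rep W u v"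
  shows "summable (\<lambda>n. cmod (cinner (W (e n)) (e (n + j))))"
proof (rule summableI_nonneg_bounded)
  fix N
  let ?f = "\<lambda>n k. cmod (cinner (e n) (u k)) * cmod (cinner (v k) (e (n + j)))"
  note s = nuclear_rep_summable[OF W]
  have f: "?f n k \<le> norm (u k) * norm (v k)" for n k
    using mult_mono[OF cinner_cauchy_schwarz[of "e n" "u k"] cinner_cauchy_schwarz[of "v k" "e (n + j)"]]
    by simp
  have sf: "summable (?f n)" for n
    by (rule summable_comparison_test'[OF s, of 0]) (simp add: f)
  have "cmod (cinner (W (e n)) (e (n + j))) \<le> (\<Sum>k. ?f n k)" for n
  proof -
    have "cinner (W (e n)) (e (n + j)) = (\<Sum>k. cinner (e n) (u k) * cinner (v k) (e (n + j)))"
      using nuclear_rep_cinner[OF W] by (simp add: sums_iff)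
    then show ?thesis
      using summable_norm[of "\<lambda>k. cinner (e n) (u k) * cinner (v k) (e (n + j))"] sf[of n]
      by (simp add: norm_mult)
  qed
  then have "(\<Sum>n<N. cmod (cinner (W (e n)) (e (n + j)))) \<le> (\<Sum>n<N. \<Sum>k. ?f n k)"
    by (rule sum_mono)
  also have "\<dots> = (\<Sum>k. \<Sum>n<N. ?f n k)"
    using suminf_sum[of "{..<N}" ?f] sf by simp
  also have "\<dots> \<le> (\<Sum>k. norm (u k) * norm (v k))"
    by (rule suminf_le[OF sum_coefficients_le summable_sum[OF sf] s])
  finally show "(\<Sum>n<N. cmod (cinner (W (e n)) (e (n + j)))) \<le> (\<Sum>k. norm (u k) * norm (v k))" .
qed simp

text \<open>Having the trace expressed by \<open>u\<close> and \<open>v\<close> makes its cyclic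
  invariance a matter of moving an operator from one argument of \<open>cinner\<close> to the
  other.\<close>

lemma nuclear_trace:
  assumes W: "nuclear_rep W u v"
  shows "(\<lambda>n. cinner (W (e n)) (e n)) sums (\<Sum>k. cinner (v k) (u k))"
proof -
  let ?f = "\<lambda>k N. \<Sum>n<N. cinner (e n) (u k) * cinner (v k) (e n)"
  have "(\<lambda>N. \<Sum>k. ?f k N) \<longlonglongrightarrow> (\<Sum>k. cinner (v k) (u k))"
  proof (rule tannery_sequence[OF _ _ nuclear_rep_summable[OF W]])
    show "?f k \<longlonglongrightarrow> cinner (v k) (u k)" for k
      using cinner_expansion[of "v k" "u k"] by (simp add: sums_def mult.commute)
    show "cmod (?f k N) \<le> norm (u k) * norm (v k)" for k N
      using sum_norm_le[of "{..<N}" "\<lambda>n. cinner (e n) (u k) * cinner (v k) (e n)"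
          "\<lambda>n. cmod (cinner (e n) (u k)) * cmod (cinner (v k) (e n))"]
        sum_coefficients_le[where j = 0 and x = "u k" and y = "v k" and N = N]
      by (simp add: norm_mult)
  qed
  moreover have "(\<Sum>k. ?f k N) = (\<Sum>n<N. cinner (W (e n)) (e n))" for N
    using suminf_sum[of "{..<N}" "\<lambda>n k. cinner (e n) (u k) * cinner (v k) (e n)"]
      nuclear_rep_cinner[OF W] by (simp add: sums_iff)
  ultimately show ?thesis
    by (simp add: sums_def)
qed

lemma bounded_operator_eproj: "bounded_operator (eproj e F)"
  unfolding eproj_def[abs_def]
proof (induction F rule: infinite_finite_induct)
  case (insert i F)
  have "bounded_operator (\<lambda>x. cinner x (e i) *\<^sub>C e i)"
    using norm_rank_one_le[of _ "e i" "e i"]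
    by (intro bounded_operator_intro[where K = 1])
      (auto simp: cinner_algebra scaleC_add_left scaleC_scaleC)
  with insert show ?case
    by (simp add: bounded_operator_plus)
qed (auto intro: bounded_operator_intro[where K = 0])

lemma norm_eproj_residual_le: "norm (x - eproj e {..<N} x) \<le> norm x"
  by (rule power2_le_imp_le) (use norm_eproj_pythagoras[OF on, of "{..<N}" x] in auto)

text \<open>Compactness in quantitative form: the tail projections tend to zero on each
  \<open>v k\<close>, and dominated convergence over \<open>k\<close> makes this uniform in
  \<open>x\<close>.\<close>

lemma nuclear_tail:
  fixes W :: "'a \<Rightarrow> 'a"
  assumes W: "nuclear_rep W u v" and "\<epsilon> > 0"
  shows "\<forall>\<^sub>F N in sequentially. \<forall>x. norm (W x - eproj e {..<N} (W x)) \<le> \<epsilon> * norm x"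
proof -
  let ?Q = "\<lambda>N x. x - eproj e {..<N} x"
  have Q: "bounded_operator (?Q N)" for N
    by (intro bounded_operator_minus bounded_operator_ident bounded_operator_eproj)
  have "(\<lambda>N. \<Sum>k. norm (u k) * norm (?Q N (v k))) \<longlonglongrightarrow> (\<Sum>k. 0 :: real)"
  proof (rule tannery_sequence[OF _ _ nuclear_rep_summable[OF W]])
    fix k
    have "(\<lambda>N. norm (u k) * norm (?Q N (v k))) \<longlonglongrightarrow> norm (u k) * norm (v k - v k)"
      by (intro tendsto_intros eproj_tendsto)
    then show "(\<lambda>N. norm (u k) * norm (?Q N (v k))) \<longlonglongrightarrow> 0"
      by simp
    show "norm (norm (u k) * norm (?Q N (v k))) \<le> norm (u k) * norm (v k)" for N
      by (simp add: mult_left_mono norm_eproj_residual_le)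
  qed
  then have "\<forall>\<^sub>F N in sequentially. (\<Sum>k. norm (u k) * norm (?Q N (v k))) < \<epsilon>"
    using \<open>\<epsilon> > 0\<close> by (intro order_tendstoD(2)) auto
  then show ?thesis
  proof eventually_elim
    case (elim N)
    show ?case
    proof
      fix x
      have "norm (?Q N (W x)) \<le> norm x * (\<Sum>k. norm (u k) * norm (?Q N (v k)))"
        by (rule nuclear_rep_norm_le[OF nuclear_rep_left[OF Q W]])
      also have "\<dots> \<le> norm x * \<epsilon>"
        using elim by (intro mult_left_mono) auto
      finally show "norm (?Q N (W x)) \<le> \<epsilon> * norm x"
        by (simp add: mult.commute)
    qed
  qed
qed

end

section \<open>Matrix entries of almost tridiagonal hyponormal operators\<close>

lemma summable_increments_convergent:
  fixes f :: "nat \<Rightarrow> 'b::banach"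
  assumes "summable (\<lambda>n. norm (f (Suc n) - f n))"
  shows "convergent f"
proof -
  have "(\<lambda>n. \<Sum>i<n. f (Suc i) - f i) \<longlonglongrightarrow> (\<Sum>i. f (Suc i) - f i)"
    by (rule summable_LIMSEQ[OF summable_norm_cancel[OF assms]])
  from tendsto_add[OF this tendsto_const[of "f 0"]] show ?thesis
    unfolding sum_lessThan_telescope by (auto simp: convergent_def)
qed

text \<open>The hypotheses \<open>s1\<close> and \<open>s2\<close> are the commutator entries at
  distance one and two. The first bounds the increments of \<open>c\<close>, the second those of
  \<open>\<rho> = |b| / |a|\<close>. If \<open>\<rho>\<close> tends to \<open>r\<close>, then
  \<open>|a|^2 = (|a|^2 - |b|^2) / (1 - \<rho>^2)\<close> tends to
  \<open>d / (1 - r^2)\<close>.\<close>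

lemma coefficient_limits:
  fixes a b c :: "nat \<Rightarrow> complex"
  assumes K: "\<And>n. cmod (a n) \<le> K"
    and d: "(\<lambda>n. (cmod (a n))\<^sup>2 - (cmod (b n))\<^sup>2) \<longlonglongrightarrow> d" "d > 0"
    and s1: "summable (\<lambda>n. cmod (cnj (b n) * (c n - c (n + 1)) + a n * cnj (c (n + 1) - c n)))"
    and s2: "summable (\<lambda>n. cmod (a n * cnj (b (n + 1)) - cnj (b n) * a (n + 1)))"
  obtains \<alpha> \<beta> \<gamma> where "0 \<le> \<beta>" "\<beta> < \<alpha>" "(\<lambda>n. cmod (a n)) \<longlonglongrightarrow> \<alpha>" "(\<lambda>n. cmod (b n)) \<longlonglongrightarrow> \<beta>" "c \<longlonglongrightarrow> \<gamma>"
proof -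
  have "\<forall>\<^sub>F n in sequentially. (cmod (a n))\<^sup>2 - (cmod (b n))\<^sup>2 > d / 2"
    using d by (intro order_tendstoD) auto
  then obtain N where N: "\<And>n. n \<ge> N \<Longrightarrow> (cmod (a n))\<^sup>2 - (cmod (b n))\<^sup>2 > d / 2"
    by (auto simp: eventually_sequentially)
  have an2: "(cmod (a n))\<^sup>2 > d / 2" if "n \<ge> N" for n
    using N[OF that] zero_le_power2[of "cmod (b n)"] by linarith
  have an: "cmod (a n) > 0" if "n \<ge> N" for n
    using an2[OF that] d(2) by (cases "a n = 0") auto
  have K0: "K > 0"
    using an[of N] K[of N] by linarith
  \<comment> \<open>From \<open>d / 2 <= (|a| - |b|) * (|a| + |b|)\<close> and
    \<open>|a| + |b| <= 2 * K\<close>.\<close>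
  define \<delta> where "\<delta> = d / (4 * K)"
  have \<delta>: "\<delta> > 0"
    using K0 d by (simp add: \<delta>_def)
  have ab: "cmod (a n) - cmod (b n) \<ge> \<delta>" if "n \<ge> N" for n
  proof -
    have "cmod (b n) < cmod (a n)"
      using N[OF that] d(2) by (intro power2_less_imp_less[of _ "cmod (a n)"]) auto
    moreover have "d / 2 \<le> (cmod (a n) - cmod (b n)) * (cmod (a n) + cmod (b n))"
      using N[OF that] by (simp add: power2_eq_square algebra_simps)
    ultimately have "d / 2 \<le> (cmod (a n) - cmod (b n)) * (2 * K)"
      using K[of n] mult_left_mono[of "cmod (a n) + cmod (b n)" "2 * K" "cmod (a n) - cmod (b n)"]
      by linarith
    then show ?thesis
      using K0 by (simp add: \<delta>_def field_simps)
  qed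
  have "summable (\<lambda>n. norm (c (Suc n) - c n))"
  proof (rule summable_comparison_test'[OF summable_mult[OF s1, of "1 / \<delta>"]])
    fix n assume n: "n \<ge> N"
    let ?D = "cmod (c (Suc n) - c n)"
    have "\<delta> * ?D \<le> (cmod (a n) - cmod (b n)) * ?D"
      using ab[OF n] by (simp add: mult_right_mono)
    also have "\<dots> = cmod (a n * cnj (c (n + 1) - c n)) - cmod (cnj (b n) * (c n - c (n + 1)))"
      by (simp add: norm_mult left_diff_distrib norm_minus_commute flip: complex_cnj_diff)
    also have "\<dots> \<le> cmod (cnj (b n) * (c n - c (n + 1)) + a n * cnj (c (n + 1) - c n))"
      by (metis add.commute norm_diff_ineq)
    finally show "norm (norm (c (Suc n) - c n)) \<le>
        1 / \<delta> * cmod (cnj (b n) * (c n - c (n + 1)) + a n * cnj (c (n + 1) - c n))"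
      using \<delta> by (simp add: field_simps)
  qed
  then obtain \<gamma> where \<gamma>: "c \<longlonglongrightarrow> \<gamma>"
    using summable_increments_convergent[of c] by (auto simp: convergent_def)
  \<comment> \<open>In the difference of consecutive ratios the numerator is
    \<open>|a n| |b (n + 1)| - |b n| |a (n + 1)|\<close>. The reverse triangle inequality bounds it
    by the summand of \<open>s2\<close>, whatever the arguments of the coefficients.\<close>
  define \<rho> where "\<rho> n = cmod (b n) / cmod (a n)" for n
  have "summable (\<lambda>n. norm (\<rho> (Suc n) - \<rho> n))"
  proof (rule summable_comparison_test'[OF summable_mult[OF s2, of "1 / (d / 2)"]])
    fix n assume n: "n \<ge> N"
    have pos: "cmod (a n) > 0" "cmod (a (Suc n)) > 0"
      using an[of n] an[of "Suc n"] n by auto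
    let ?X = "cmod (a n * cnj (b (n + 1)) - cnj (b n) * a (n + 1))"
    have "\<rho> (Suc n) - \<rho> n = (cmod (a n) * cmod (b (Suc n)) - cmod (b n) * cmod (a (Suc n))) /
        (cmod (a n) * cmod (a (Suc n)))"
      using pos unfolding \<rho>_def by (subst diff_frac_eq) (auto simp: mult_ac)
    then have "\<bar>\<rho> (Suc n) - \<rho> n\<bar> = \<bar>cmod (a n) * cmod (b (Suc n)) - cmod (b n) * cmod (a (Suc n))\<bar> /
        (cmod (a n) * cmod (a (Suc n)))"
      by (simp add: abs_mult)
    also have "\<dots> \<le> ?X / (cmod (a n) * cmod (a (Suc n)))"
      using norm_triangle_ineq3[of "a n * cnj (b (n + 1))" "cnj (b n) * a (n + 1)"] pos
      by (intro divide_right_mono) (auto simp: norm_mult)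
    also have "\<dots> \<le> ?X / (d / 2)"
    proof (rule divide_left_mono)
      have "(d / 2)\<^sup>2 \<le> (cmod (a n) * cmod (a (Suc n)))\<^sup>2"
        unfolding power_mult_distrib power2_eq_square[of "d / 2"]
        using an2[of n] an2[of "Suc n"] n d(2) by (intro mult_mono) auto
      then show "d / 2 \<le> cmod (a n) * cmod (a (Suc n))"
        by (rule power2_le_imp_le) auto
    qed (use pos d(2) in auto)
    finally show "norm (norm (\<rho> (Suc n) - \<rho> n)) \<le> 1 / (d / 2) * ?X"
      by (simp add: mult.commute)
  qed
  then obtain r where r: "\<rho> \<longlonglongrightarrow> r"
    using summable_increments_convergent[of \<rho>] by (auto simp: convergent_def)
  have r0: "r \<ge> 0"
    by (rule LIMSEQ_le_const[OF r]) (auto simp: \<rho>_def)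
  have rho: "(cmod (a n))\<^sup>2 * (1 - (\<rho> n)\<^sup>2) = (cmod (a n))\<^sup>2 - (cmod (b n))\<^sup>2" if "n \<ge> N" for n
    using an[OF that] by (simp add: \<rho>_def power_divide algebra_simps)
  have "(\<lambda>n. 1 - (\<rho> n)\<^sup>2) \<longlonglongrightarrow> 1 - r\<^sup>2"
    using r by (intro tendsto_intros)
  \<comment> \<open>A lower bound independent of \<open>n\<close> is required:
    \<open>\<rho> n < 1\<close> for each \<open>n\<close> would only give
    \<open>r <= 1\<close>.\<close>
  moreover have "d / (2 * K\<^sup>2) \<le> 1 - (\<rho> n)\<^sup>2" if "n \<ge> N" for n
  proof -
    have *: "d / 2 \<le> (cmod (a n))\<^sup>2 * (1 - (\<rho> n)\<^sup>2)"
      using rho[OF that] N[OF that] by simp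
    moreover have "0 \<le> 1 - (\<rho> n)\<^sup>2"
      using * d(2) mult_nonneg_nonpos[of "(cmod (a n))\<^sup>2" "1 - (\<rho> n)\<^sup>2"] by fastforce
    moreover have "(cmod (a n))\<^sup>2 \<le> K\<^sup>2"
      using K[of n] by (simp add: power_mono)
    ultimately have "d / 2 \<le> K\<^sup>2 * (1 - (\<rho> n)\<^sup>2)"
      by (meson mult_right_mono order_trans)
    then show ?thesis
      using K0 by (simp add: field_simps)
  qed
  ultimately have "d / (2 * K\<^sup>2) \<le> 1 - r\<^sup>2"
    by (intro LIMSEQ_le_const) auto
  moreover have "d / (2 * K\<^sup>2) > 0"
    using d(2) K0 by simp
  ultimately have r1: "1 - r\<^sup>2 > 0"
    by linarith
  have r_less: "r < 1"
    using r1 r0 by (simp add: power2_eq_square abs_square_less_1[unfolded power2_eq_square])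
  have "(\<lambda>n. ((cmod (a n))\<^sup>2 - (cmod (b n))\<^sup>2) / (1 - (\<rho> n)\<^sup>2)) \<longlonglongrightarrow> d / (1 - r\<^sup>2)"
    using r d(1) r1 by (intro tendsto_intros) auto
  moreover have "\<forall>\<^sub>F n in sequentially.
      ((cmod (a n))\<^sup>2 - (cmod (b n))\<^sup>2) / (1 - (\<rho> n)\<^sup>2) = (cmod (a n))\<^sup>2"
    using eventually_ge_at_top[of N]
  proof eventually_elim
    case (elim n)
    have "1 - (\<rho> n)\<^sup>2 \<noteq> 0"
      using rho[OF elim] N[OF elim] d(2) by auto
    then show ?case
      using rho[OF elim] by (simp add: field_simps)
  qed
  ultimately have "(\<lambda>n. (cmod (a n))\<^sup>2) \<longlonglongrightarrow> d / (1 - r\<^sup>2)"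
    by (rule Lim_transform_eventually)
  from tendsto_real_sqrt[OF this]
  have \<alpha>: "(\<lambda>n. cmod (a n)) \<longlonglongrightarrow> sqrt (d / (1 - r\<^sup>2))" (is "_ \<longlonglongrightarrow> ?\<alpha>")
    by simp
  have \<alpha>0: "?\<alpha> > 0"
    using d(2) r1 by simp
  have "(\<lambda>n. \<rho> n * cmod (a n)) \<longlonglongrightarrow> r * ?\<alpha>"
    by (intro tendsto_intros r \<alpha>)
  moreover have "\<forall>\<^sub>F n in sequentially. \<rho> n * cmod (a n) = cmod (b n)"
    using eventually_ge_at_top[of N] by eventually_elim (use an in \<open>fastforce simp: \<rho>_def\<close>)
  ultimately have \<beta>: "(\<lambda>n. cmod (b n)) \<longlonglongrightarrow> r * ?\<alpha>"
    by (rule Lim_transform_eventually)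
  show ?thesis
    by (rule that[OF _ _ \<alpha> \<beta> \<gamma>]) (use r0 r_less \<alpha>0 in auto)
qed

lemma hyponormal_bounded: "hyponormal T \<Longrightarrow> bounded_operator T"
  by (simp add: hyponormal_def)

context hilbert_basis
begin

lemma cinner_self_commutator:
  fixes T :: "'a \<Rightarrow> 'a"
  assumes "bounded_operator T"
  shows "cinner (self_commutator T x) y = cinner (T x) (T y) - cinner (cadjoint T x) (cadjoint T y)"
  using assms
  by (simp add: self_commutator_def cinner_diff_left cinner_cadjoint_left cinner_cadjoint_right)

lemma tridiagonal_cadjoint:
  fixes R :: "'a \<Rightarrow> 'a"
  assumes "bounded_operator R" "tridiagonal e R"
  shows "tridiagonal e (cadjoint R)"
  using assms(2) unfolding tridiagonal_def cinner_cadjoint_left[OF assms(1)]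
  by (metis abs_minus_commute cinner_commute complex_cnj_zero)

lemma finite_basis_expansion:
  assumes "finite F" "\<And>m. m \<notin> F \<Longrightarrow> cinner x (e m) = 0"
  shows "x = (\<Sum>m\<in>F. cinner x (e m) *\<^sub>C e m)"
  by (rule sums_unique2[OF basis_expansion sums_finite[OF assms(1)]]) (simp add: assms(2))

lemma tridiagonal_0:
  assumes "tridiagonal e R"
  shows "R (e 0) = cinner (R (e 0)) (e 0) *\<^sub>C e 0 + cinner (R (e 0)) (e 1) *\<^sub>C e 1"
  using finite_basis_expansion[of "{0, 1}" "R (e 0)"] assms by (simp add: tridiagonal_def)

lemma tridiagonal_Suc:
  assumes "tridiagonal e R"
  shows "R (e (Suc n)) = cinner (R (e (Suc n))) (e n) *\<^sub>C e n +
    cinner (R (e (Suc n))) (e (Suc n)) *\<^sub>C e (Suc n) +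
    cinner (R (e (Suc n))) (e (Suc (Suc n))) *\<^sub>C e (Suc (Suc n))"
proof -
  have "cinner (R (e (Suc n))) (e m) = 0" if "m \<notin> {n, Suc n, Suc (Suc n)}" for m
  proof -
    have "\<bar>int m - int (Suc n)\<bar> \<ge> 2"
      using that by auto
    then show ?thesis
      using assms by (simp add: tridiagonal_def)
  qed
  from finite_basis_expansion[of "{n, Suc n, Suc (Suc n)}", OF _ this] show ?thesis
    by (simp add: add.assoc)
qed

text \<open>\<open>C\<close> is the sesquilinear form of the self-commutator of \<open>R\<close>.
  Its diagonal entry at \<open>n + 1\<close> is the increment of \<open>|a n|^2 - |b n|^2\<close>,
  and the entry at 0 has no lower neighbour, so the partial sums telescope exactly.\<close>

lemma tridiagonal_commutator_entries:
  fixes R :: "'a \<Rightarrow> 'a"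
  assumes R: "bounded_operator R" "tridiagonal e R"
  defines "a \<equiv> \<lambda>n. cinner (R (e n)) (e (Suc n))"
    and "b \<equiv> \<lambda>n. cinner (R (e (Suc n))) (e n)"
    and "c \<equiv> \<lambda>n. cinner (R (e n)) (e n)"
  defines "C \<equiv> \<lambda>x y. cinner (R x) (R y) - cinner (cadjoint R x) (cadjoint R y)"
  shows "(\<Sum>i<Suc n. C (e i) (e i)) = complex_of_real ((cmod (a n))\<^sup>2 - (cmod (b n))\<^sup>2)"
    and "C (e n) (e (n + 1)) = cnj (b n) * (c n - c (n + 1)) + a n * cnj (c (n + 1) - c n)"
    and "C (e n) (e (n + 2)) = a n * cnj (b (n + 1)) - cnj (b n) * a (n + 1)"
proof -
  note adj = cinner_cadjoint_left[OF R(1)]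
  have cnj_ab: "cinner (e n) (R (e (Suc n))) = cnj (b n)" "cinner (e (Suc n)) (R (e n)) = cnj (a n)"
    "cinner (e n) (R (e n)) = cnj (c n)" for n
    by (simp_all add: a_def b_def c_def flip: cinner_commute)
  have R0: "R (e 0) = c 0 *\<^sub>C e 0 + a 0 *\<^sub>C e 1"
    using tridiagonal_0[OF R(2)] by (simp add: a_def c_def)
  have RS: "R (e (Suc n)) = b n *\<^sub>C e n + c (Suc n) *\<^sub>C e (Suc n) + a (Suc n) *\<^sub>C e (Suc (Suc n))" for n
    using tridiagonal_Suc[OF R(2), of n] by (simp add: a_def b_def c_def)
  have S0: "cadjoint R (e 0) = cnj (c 0) *\<^sub>C e 0 + cnj (b 0) *\<^sub>C e 1"
    using tridiagonal_0[OF tridiagonal_cadjoint[OF R]] by (simp add: adj cnj_ab)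
  have SS: "cadjoint R (e (Suc n)) =
      cnj (a n) *\<^sub>C e n + cnj (c (Suc n)) *\<^sub>C e (Suc n) + cnj (b (Suc n)) *\<^sub>C e (Suc (Suc n))" for n
    using tridiagonal_Suc[OF tridiagonal_cadjoint[OF R], of n] by (simp add: adj cnj_ab)
  note expand = C_def R0 RS S0 SS cinner_algebra algebra_simps
  show "(\<Sum>i<Suc n. C (e i) (e i)) = complex_of_real ((cmod (a n))\<^sup>2 - (cmod (b n))\<^sup>2)"
    unfolding of_real_diff complex_norm_square
  proof (induction n)
    case 0
    show ?case by (simp add: expand)
  next
    case (Suc n)
    have "C (e (Suc n)) (e (Suc n)) =
        b n * cnj (b n) + a (Suc n) * cnj (a (Suc n)) - a n * cnj (a n) - b (Suc n) * cnj (b (Suc n))"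
      by (simp add: expand)
    with Suc show ?case by simp
  qed
  show "C (e n) (e (n + 1)) = cnj (b n) * (c n - c (n + 1)) + a n * cnj (c (n + 1) - c n)"
    by (cases n) (simp_all add: expand)
  show "C (e n) (e (n + 2)) = a n * cnj (b (n + 1)) - cnj (b n) * a (n + 1)"
    by (cases n) (simp_all add: expand)
qed

text \<open>Both traces equal the sum over \<open>k\<close> of
  \<open>cinner (v k) (A (u k))\<close>.\<close>

lemma nuclear_trace_commute:
  fixes A V :: "'a \<Rightarrow> 'a"
  assumes A: "bounded_operator A" and V: "nuclear_rep V u v"
  obtains \<tau> where "(\<lambda>n. cinner (cadjoint A (V (e n))) (e n)) sums \<tau>"
    "(\<lambda>n. cinner (V (cadjoint A (e n))) (e n)) sums \<tau>"
proof -
  note A' = bounded_operator_cadjoint[OF A]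
  have "(\<lambda>n. cinner (cadjoint A (V (e n))) (e n)) sums (\<Sum>k. cinner (v k) (A (u k)))"
    using nuclear_trace[OF nuclear_rep_left[OF A' V]] by (simp add: cinner_cadjoint_left[OF A])
  moreover have "(\<lambda>n. cinner (V (cadjoint A (e n))) (e n)) sums (\<Sum>k. cinner (v k) (A (u k)))"
    using nuclear_trace[OF nuclear_rep_right[OF A' V]] by (simp add: cadjoint_cadjoint[OF A])
  ultimately show ?thesis
    using that by blast
qed

lemma almost_tridiagonal_hyponormal_limits:
  fixes T R V :: "'a \<Rightarrow> 'a"
  assumes T: "hyponormal T" and not_normal: "norm (T x) \<noteq> norm (cadjoint T x)"
    and R: "bounded_operator R" "tridiagonal e R"
    and V: "bounded_operator V" "nuclear_rep V u v" and TRV: "\<And>x. T x = R x + V x"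
  defines "a \<equiv> \<lambda>n. cinner (R (e n)) (e (Suc n))"
    and "b \<equiv> \<lambda>n. cinner (R (e (Suc n))) (e n)"
    and "c \<equiv> \<lambda>n. cinner (R (e n)) (e n)"
  obtains \<alpha> \<beta> \<gamma> where "0 \<le> \<beta>" "\<beta> < \<alpha>" "(\<lambda>n. cmod (a n)) \<longlonglongrightarrow> \<alpha>" "(\<lambda>n. cmod (b n)) \<longlonglongrightarrow> \<beta>" "c \<longlonglongrightarrow> \<gamma>"
proof -
  note bT = hyponormal_bounded[OF T]
  have D: "positive_operator (self_commutator T)"
    using T by (simp add: hyponormal_def)
  have adjT: "cadjoint T = (\<lambda>x. cadjoint R x + cadjoint V x)"
    by (rule cadjoint_eqI[OF bT])
      (simp add: TRV cinner_algebra cinner_cadjoint_left[OF R(1)] cinner_cadjoint_left[OF V(1)])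
  define C where "C x y = cinner (R x) (R y) - cinner (cadjoint R x) (cadjoint R y)" for x y
  \<comment> \<open>Keeping one factor \<open>T\<close> or \<open>cadjoint T\<close> unexpanded
    leaves four cross terms, each containing \<open>V\<close> or its adjoint exactly once as an
    outer or inner factor.\<close>
  define E where "E x y = cinner (cadjoint T (V x)) y + cinner (cadjoint V (R x)) y
    - cinner (T (cadjoint V x)) y - cinner (V (cadjoint R x)) y" for x y
  have DCE: "cinner (self_commutator T x) y = C x y + E x y" for x y
  proof -
    note move = cinner_cadjoint_left[OF V(1)] cinner_cadjoint_left[OF bT]
      cinner_cadjoint_right[OF V(1), symmetric] cinner_cadjoint_right[OF bT, symmetric]
    have "E x y = cinner (V x) (T y) + cinner (R x) (V y)
        - cinner (cadjoint V x) (cadjoint T y) - cinner (cadjoint R x) (cadjoint V y)"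
      unfolding E_def move by simp
    then show ?thesis
      unfolding cinner_self_commutator[OF bT] C_def adjT TRV by (simp add: cinner_algebra)
  qed
  note nuclearV' = nuclear_rep_cadjoint[OF V]
  have E_summable: "summable (\<lambda>n. cmod (E (e n) (e (n + j))))" for j
  proof (rule summable_comparison_test'[of _ 0])
    show "summable (\<lambda>n. cmod (cinner (cadjoint T (V (e n))) (e (n + j)))
        + cmod (cinner (cadjoint V (R (e n))) (e (n + j)))
        + cmod (cinner (T (cadjoint V (e n))) (e (n + j)))
        + cmod (cinner (V (cadjoint R (e n))) (e (n + j))))"
      by (intro summable_add
          nuclear_diagonal_summable[OF nuclear_rep_left[OF bounded_operator_cadjoint[OF bT] V(2)]]
          nuclear_diagonal_summable[OF nuclear_rep_right[OF R(1) nuclearV']]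
          nuclear_diagonal_summable[OF nuclear_rep_left[OF bT nuclearV']]
          nuclear_diagonal_summable[OF nuclear_rep_right[OF bounded_operator_cadjoint[OF R(1)] V(2)]])
    fix n
    have "cmod (p + q - r - s) \<le> cmod p + cmod q + cmod r + cmod s" for p q r s
      by (smt (verit) norm_triangle_ineq norm_triangle_ineq4)
    then show "norm (cmod (E (e n) (e (n + j)))) \<le>
        cmod (cinner (cadjoint T (V (e n))) (e (n + j)))
        + cmod (cinner (cadjoint V (R (e n))) (e (n + j)))
        + cmod (cinner (T (cadjoint V (e n))) (e (n + j)))
        + cmod (cinner (V (cadjoint R (e n))) (e (n + j)))"
      by (simp add: E_def)
  qed
  have E_trace: "(\<lambda>n. Re (E (e n) (e n))) sums 0"
  proof -
    obtain \<tau>\<^sub>1 where \<tau>\<^sub>1: "(\<lambda>n. cinner (cadjoint T (V (e n))) (e n)) sums \<tau>\<^sub>1"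
      "(\<lambda>n. cinner (V (cadjoint T (e n))) (e n)) sums \<tau>\<^sub>1"
      using nuclear_trace_commute[OF bT V(2)] by metis
    obtain \<tau>\<^sub>2 where \<tau>\<^sub>2: "(\<lambda>n. cinner (cadjoint R (V (e n))) (e n)) sums \<tau>\<^sub>2"
      "(\<lambda>n. cinner (V (cadjoint R (e n))) (e n)) sums \<tau>\<^sub>2"
      using nuclear_trace_commute[OF R(1) V(2)] by metis
    \<comment> \<open>Two of the four terms are adjoints of products with \<open>V\<close> itself.
      Taking real parts turns \<open>E\<close> into two differences of the type treated in
      \<open>nuclear_trace_commute\<close>, each of trace zero.\<close>
    have "cinner (T (cadjoint V x)) x = cnj (cinner (V (cadjoint T x)) x)"
      "cinner (cadjoint V (R x)) x = cnj (cinner (cadjoint R (V x)) x)" for x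
      by (metis cinner_commute cinner_cadjoint_left cinner_cadjoint_right bT V(1) R(1))+
    then have "Re (E x x) = Re (cinner (cadjoint T (V x)) x) + Re (cinner (cadjoint R (V x)) x)
        - Re (cinner (V (cadjoint T x)) x) - Re (cinner (V (cadjoint R x)) x)" for x
      by (simp add: E_def)
    moreover have "(\<lambda>n. Re (cinner (cadjoint T (V (e n))) (e n)) + Re (cinner (cadjoint R (V (e n))) (e n))
        - Re (cinner (V (cadjoint T (e n))) (e n)) - Re (cinner (V (cadjoint R (e n))) (e n)))
        sums (Re \<tau>\<^sub>1 + Re \<tau>\<^sub>2 - Re \<tau>\<^sub>1 - Re \<tau>\<^sub>2)"
      by (intro sums_add sums_diff sums_Re \<tau>\<^sub>1 \<tau>\<^sub>2)
    ultimately show ?thesis by simp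
  qed
  obtain K where K: "K > 0" "\<And>x. norm (R x) \<le> K * norm x"
    using bounded_operator_bound[OF R(1)] by metis
  have a_le: "cmod (a n) \<le> K" for n
    unfolding a_def using cinner_cauchy_schwarz[of "R (e n)" "e (Suc n)"] K(2)[of "e n"] by simp
  have C_diag: "(\<Sum>i<Suc n. C (e i) (e i)) = complex_of_real ((cmod (a n))\<^sup>2 - (cmod (b n))\<^sup>2)" for n
    unfolding C_def a_def b_def by (rule tridiagonal_commutator_entries(1)[OF R])
  have C_1: "C (e n) (e (n + 1)) = cnj (b n) * (c n - c (n + 1)) + a n * cnj (c (n + 1) - c n)" for n
    unfolding C_def a_def b_def c_def by (rule tridiagonal_commutator_entries(2)[OF R])
  have C_2: "C (e n) (e (n + 2)) = a n * cnj (b (n + 1)) - cnj (b n) * a (n + 1)" for n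
    unfolding C_def a_def b_def c_def by (rule tridiagonal_commutator_entries(3)[OF R])
  define \<delta> where "\<delta> n = Re (cinner (self_commutator T (e n)) (e n))" for n
  have \<delta>: "\<delta> n \<ge> 0" "cinner (self_commutator T (e n)) (e n) = complex_of_real (\<delta> n)" for n
    using D by (auto simp: \<delta>_def positive_operator_def complex_nonneg_Reals_iff complex_eq_iff)
  have partial: "(\<Sum>i<Suc n. \<delta> i) = (cmod (a n))\<^sup>2 - (cmod (b n))\<^sup>2 + (\<Sum>i<Suc n. Re (E (e i) (e i)))" for n
  proof -
    have "(\<Sum>i<Suc n. \<delta> i) = Re (\<Sum>i<Suc n. C (e i) (e i)) + (\<Sum>i<Suc n. Re (E (e i) (e i)))"
      unfolding \<delta>_def DCE plus_complex.sel sum.distrib Re_sum by simp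
    then show ?thesis
      unfolding C_diag by simp
  qed
  have "Bseq (\<lambda>n. \<Sum>i<n. Re (E (e i) (e i)))"
    using E_trace by (intro convergent_imp_Bseq) (auto simp: sums_def convergent_def)
  then obtain B where B: "\<And>n. \<bar>\<Sum>i<n. Re (E (e i) (e i))\<bar> \<le> B"
    by (auto simp: Bseq_def)
  \<comment> \<open>Hyponormality enters here: the \<open>\<delta> i\<close> are nonnegative, so the
    bound on \<open>|a n|\<close> and on the partial traces of \<open>E\<close> already gives
    summability.\<close>
  have "(\<Sum>i<n. \<delta> i) \<le> K\<^sup>2 + B" for n
  proof -
    have "(\<Sum>i<n. \<delta> i) \<le> (\<Sum>i<Suc n. \<delta> i)"
      using \<delta>(1)[of n] by simp
    also have "\<dots> \<le> K\<^sup>2 + B"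
      unfolding partial using power_mono[OF a_le, of n 2] zero_le_power2[of "cmod (b n)"] B[of "Suc n"]
      by (smt (verit) norm_ge_zero)
    finally show ?thesis .
  qed
  then have \<delta>_summable: "summable \<delta>"
    by (intro summableI_nonneg_bounded[OF \<delta>(1)])
  define d where "d = suminf \<delta>"
  have "(\<lambda>n. (\<Sum>i<Suc n. \<delta> i) - (\<Sum>i<Suc n. Re (E (e i) (e i)))) \<longlonglongrightarrow> d - 0"
    unfolding d_def using summable_LIMSEQ[OF \<delta>_summable] E_trace[unfolded sums_def]
    by (intro tendsto_diff LIMSEQ_Suc)
  then have d_lim: "(\<lambda>n. (cmod (a n))\<^sup>2 - (cmod (b n))\<^sup>2) \<longlonglongrightarrow> d"
    unfolding partial by simp
  have "d > 0"
  proof (rule ccontr)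
    assume "\<not> d > 0"
    then have "d = 0"
      using suminf_nonneg[OF \<delta>_summable \<delta>(1)] by (simp add: d_def)
    then have "\<delta> n = 0" for n
      using suminf_eq_zero_iff[OF \<delta>_summable \<delta>(1)] by (simp add: d_def)
    then have "self_commutator T (e n) = 0" for n
      using positive_operator_null[OF D] \<delta>(2) by simp
    then have "self_commutator T x = 0"
      using bounded_operator_eq_0_closure[OF _ _ basis] D by (simp add: positive_operator_def)
    then have "cinner (T x) (T x) = cinner (cadjoint T x) (cadjoint T x)"
      using cinner_self_commutator[OF bT, of x x] by simp
    then have "(norm (T x))\<^sup>2 = (norm (cadjoint T x))\<^sup>2"
      by (simp add: norm_eq_cinner)
    with not_normal show False
      by simp
  qed
  have D_summable: "summable (\<lambda>n. cmod (cinner (self_commutator T (e n)) (e (n + j))))" for j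
  proof (rule summable_comparison_test'[of _ 0])
    \<comment> \<open>By Cauchy-Schwarz for the form of \<open>D\<close> an entry is at most the
      geometric mean of two diagonal entries, hence at most their arithmetic mean.\<close>
    show "summable (\<lambda>n. (\<delta> n + \<delta> (n + j)) / 2)"
      by (intro summable_divide summable_add \<delta>_summable summable_ignore_initial_segment)
    fix n
    have "(cmod (cinner (self_commutator T (e n)) (e (n + j))))\<^sup>2 \<le> \<delta> n * \<delta> (n + j)"
      using positive_operator_cauchy_schwarz[OF D] by (simp add: \<delta>_def)
    also have "\<dots> \<le> ((\<delta> n + \<delta> (n + j)) / 2)\<^sup>2"
      using zero_le_power2[of "\<delta> n - \<delta> (n + j)"] by (simp add: power2_eq_square algebra_simps)
    finally show "norm (cmod (cinner (self_commutator T (e n)) (e (n + j)))) \<le> (\<delta> n + \<delta> (n + j)) / 2"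
      using power2_le_imp_le \<delta>(1) by simp
  qed
  have C_summable: "summable (\<lambda>n. cmod (C (e n) (e (n + j))))" for j
  proof (rule summable_comparison_test'[OF summable_add[OF D_summable E_summable], of 0])
    fix n
    have "C (e n) (e (n + j)) = cinner (self_commutator T (e n)) (e (n + j)) - E (e n) (e (n + j))"
      by (simp add: DCE)
    then show "norm (cmod (C (e n) (e (n + j)))) \<le>
        cmod (cinner (self_commutator T (e n)) (e (n + j))) + cmod (E (e n) (e (n + j)))"
      by (simp add: norm_triangle_ineq4)
  qed
  show ?thesis
    using coefficient_limits[OF a_le d_lim \<open>d > 0\<close> C_summable[of 1, unfolded C_1]
        C_summable[of 2, unfolded C_2]] that by metis
qed

end

section \<open>An eigenvector of the adjoint\<close>

text \<open>The relation is indexed by numbers, not vectors, so that it transfers to the preimages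
  \<open>w i\<close> later; a repetition \<open>g i = g j\<close> is then a relation in
  itself.\<close>

lemma linear_dependence:
  fixes g :: "nat \<Rightarrow> 'a::complex_hilbert_space"
  assumes X: "finite X" "card X \<le> N" and g: "\<And>i. i \<le> N \<Longrightarrow> g i \<in> complex_vector.span X"
  obtains t where "\<exists>i\<le>N. t i \<noteq> 0" "(\<Sum>i\<le>N. t i *\<^sub>C g i) = 0"
proof (cases "inj_on g {..N}")
  case True
  have "\<not> complex_vector.independent (g ` {..N})"
  proof
    assume "complex_vector.independent (g ` {..N})"
    then have "card (g ` {..N}) \<le> card X"
      using complex_vector.independent_span_bound[OF X(1)] g by auto
    then show False
      using X(2) by (simp add: card_image[OF True])
  qed
  then obtain s where s: "\<exists>x\<in>g ` {..N}. s x \<noteq> 0" "(\<Sum>x\<in>g ` {..N}. s x *\<^sub>C x) = 0"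
    using complex_vector.dependent_finite[of "g ` {..N}"] by auto
  show ?thesis
    by (rule that[of "s \<circ> g"]) (use s in \<open>auto simp: sum.reindex[OF True]\<close>)
next
  case False
  then obtain i j where ij: "i \<le> N" "j \<le> N" "i \<noteq> j" "g i = g j"
    by (auto simp: inj_on_def)
  define t :: "nat \<Rightarrow> complex" where "t k = (if k = i then 1 else if k = j then -1 else 0)" for k
  have "(\<Sum>k\<le>N. t k *\<^sub>C g k) = (\<Sum>k\<in>{i, j}. t k *\<^sub>C g k)"
    using ij by (intro sum.mono_neutral_right) (auto simp: t_def)
  also have "\<dots> = 0"
    using ij by (simp add: t_def)
  finally have "(\<Sum>k\<le>N. t k *\<^sub>C g k) = 0" .
  with ij(1) show ?thesis
    by (intro that[of t] exI[of _ i]) (auto simp: t_def)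
qed

text \<open>\<open>x \<mapsto> y - F x\<close> is a contraction, and its fixed point is the
  solution.\<close>

lemma neumann_surjective:
  assumes F: "bounded_operator (F :: 'a::complex_hilbert_space \<Rightarrow> 'a)"
    and q: "\<And>x. norm (F x) \<le> q * norm x" "0 \<le> q" "q < 1"
  obtains z where "z + F z = y"
proof -
  have "dist (y - F x) (y - F x') \<le> q * dist x x'" for x x'
    using q(1)[of "x' - x"] by (simp add: dist_norm bounded_operator_diff[OF F] norm_minus_commute)
  then obtain z where "y - F z = z"
    using banach_fix_type[of q "\<lambda>x. y - F x"] q(2,3) by auto
  then show ?thesis
    using that[of z] by (simp add: algebra_simps)
qed

context hilbert_basis
begin

lemma eproj_basis: "finite F \<Longrightarrow> eproj e F (e n) = (if n \<in> F then e n else 0)"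
  by (simp add: eproj_def if_distrib[of "\<lambda>c. c *\<^sub>C _"] cong: if_cong)

text \<open>It serves to show that the error terms have no coordinates below \<open>N\<close> and
  that the range of \<open>J\<close> has none up to and including \<open>N\<close>.\<close>

lemma weighted_shift_orthogonal:
  fixes W :: "'a \<Rightarrow> 'a"
  assumes W: "bounded_operator W" "\<And>n. W (e n) = t n *\<^sub>C e (\<sigma> n)"
    and F: "finite F" "\<And>n. \<sigma> n \<in> F \<Longrightarrow> t n = 0"
  shows "eproj e F (W x) = 0"
proof (rule operator_eqI[of "\<lambda>x. eproj e F (W x)" "\<lambda>x. 0"])
  show "bounded_operator (\<lambda>x. eproj e F (W x))"
    by (rule bounded_operator_compose[OF bounded_operator_eproj W(1)])
  show "bounded_operator (\<lambda>x. 0 :: 'a)"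
    by (rule bounded_operator_intro[where K = 0]) auto
  show "eproj e F (W (e n)) = 0" for n
    using F by (auto simp: W(2) bounded_operator_scaleC[OF bounded_operator_eproj] eproj_basis)
qed

text \<open>
  Modulo a small operator, the compression of \<open>R\<^sup>* - cnj \<gamma>\<close> to the span of the basis vectors from
  \<open>N\<close> onwards is a weighted backward shift, with right inverse \<open>J\<close>. The remaining block of the
  matrix has \<open>N + 1\<close> columns but only \<open>N\<close> rows, so it has a kernel.
\<close>

lemma adjoint_eigenvector:
  fixes R V :: "'a \<Rightarrow> 'a"
  assumes R: "bounded_operator R" "tridiagonal e R"
    and V: "bounded_operator V" "nuclear_rep V u v" and TRV: "T = (\<lambda>x. R x + V x)"
  defines "a \<equiv> \<lambda>n. cinner (R (e n)) (e (Suc n))"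
    and "b \<equiv> \<lambda>n. cinner (R (e (Suc n))) (e n)"
    and "c \<equiv> \<lambda>n. cinner (R (e n)) (e n)"
  assumes lim: "0 \<le> \<beta>" "\<beta> < \<alpha>" "(\<lambda>n. cmod (a n)) \<longlonglongrightarrow> \<alpha>" "(\<lambda>n. cmod (b n)) \<longlonglongrightarrow> \<beta>" "c \<longlonglongrightarrow> \<gamma>"
  obtains x where "x \<noteq> 0" "cadjoint T x = cnj \<gamma> *\<^sub>C x"
proof -
  \<comment> \<open>The three perturbations add up to at most
    \<open>\<beta> + 3 * \<epsilon>\<close>, to be compared with weights above
    \<open>\<alpha> - \<epsilon>\<close>. Any \<open>\<epsilon>\<close> with
    \<open>4 * \<epsilon> < \<alpha> - \<beta>\<close> makes the quotient \<open>q\<close> less than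
    one.\<close>
  define \<epsilon> where "\<epsilon> = (\<alpha> - \<beta>) / 8"
  have \<epsilon>: "\<epsilon> > 0" using lim(2) by (simp add: \<epsilon>_def)
  have "\<forall>\<^sub>F n in sequentially. cmod (a n) > \<alpha> - \<epsilon>" "\<forall>\<^sub>F n in sequentially. cmod (b n) < \<beta> + \<epsilon>"
    using lim(3,4) \<epsilon> by (auto intro: order_tendstoD)
  moreover have "\<forall>\<^sub>F n in sequentially. cmod (c n - \<gamma>) < \<epsilon>"
    using lim(5) \<epsilon> by (simp add: tendsto_iff dist_norm)
  moreover note nuclear_tail[OF nuclear_rep_cadjoint[OF V] \<epsilon>]
  ultimately have "\<forall>\<^sub>F n in sequentially. cmod (a n) > \<alpha> - \<epsilon> \<and> cmod (b n) < \<beta> + \<epsilon> \<and> cmod (c n - \<gamma>) < \<epsilon>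
      \<and> (\<forall>x. norm (cadjoint V x - eproj e {..<n} (cadjoint V x)) \<le> \<epsilon> * norm x)"
    by eventually_elim simp
  then obtain N where N: "\<And>n. n \<ge> N \<Longrightarrow> cmod (a n) > \<alpha> - \<epsilon>" "\<And>n. n \<ge> N \<Longrightarrow> cmod (b n) < \<beta> + \<epsilon>"
    "\<And>n. n \<ge> N \<Longrightarrow> cmod (c n - \<gamma>) < \<epsilon>"
    and tail: "\<And>x. norm (cadjoint V x - eproj e {..<N} (cadjoint V x)) \<le> \<epsilon> * norm x"
    unfolding eventually_sequentially by blast
  define m where "m = \<alpha> - \<epsilon>"
  have m: "m > 0"
    using lim(1,2) by (simp add: m_def \<epsilon>_def)
  have a0: "a n \<noteq> 0" if "n \<ge> N" for n
    using N(1)[OF that] m by (auto simp: m_def)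
  have quotient: "cmod (if n \<ge> N then s / cnj (a n) else 0) \<le> p / m"
    if "n \<ge> N \<Longrightarrow> cmod s \<le> p" "p \<ge> 0" for s p n
    using that N(1)[of n] m by (auto simp: norm_divide m_def intro!: frac_le)
  \<comment> \<open>For \<open>n \<ge> N\<close>, applying \<open>cadjoint R - cnj \<gamma>\<close>
    to \<open>J (e n)\<close> gives
    \<open>e n + t1 n *\<^sub>C e (n + 1) + t2 n *\<^sub>C e (n + 2)\<close>, so \<open>J\<close>
    inverts the leading backward shift and \<open>W1\<close>, \<open>W2\<close> collect the rest.
    Cutting the weights off below \<open>N\<close> confines all images to indices above
    \<open>N\<close>.\<close>
  define tJ where "tJ n = (if n \<ge> N then 1 / cnj (a n) else 0)" for n
  define t1 where "t1 n = (if n \<ge> N then cnj (c (Suc n) - \<gamma>) / cnj (a n) else 0)" for n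
  define t2 where "t2 n = (if n \<ge> N then cnj (b (Suc n)) / cnj (a n) else 0)" for n
  have tJ: "cmod (tJ n) \<le> 1 / m" for n
    unfolding tJ_def by (rule quotient) auto
  have t1: "cmod (t1 n) \<le> \<epsilon> / m" for n
    unfolding t1_def
  proof (rule quotient)
    show "cmod (cnj (c (Suc n) - \<gamma>)) \<le> \<epsilon>" if "n \<ge> N"
      using N(3)[of "Suc n"] that by (simp only: complex_mod_cnj) simp
  qed (use \<epsilon> in simp)
  have t2: "cmod (t2 n) \<le> (\<beta> + \<epsilon>) / m" for n
    unfolding t2_def
  proof (rule quotient)
    show "cmod (cnj (b (Suc n))) \<le> \<beta> + \<epsilon>" if "n \<ge> N"
      using N(2)[of "Suc n"] that by (simp only: complex_mod_cnj) simp
  qed (use \<epsilon> lim(1) in simp)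
  obtain J where J: "bounded_operator J" "\<And>n. J (e n) = tJ n *\<^sub>C e (Suc n)" "\<And>x. norm (J x) \<le> 1 / m * norm x"
    using weighted_shift_exists[where t = tJ, OF inj_Suc tJ] by blast
  obtain W1 where W1: "bounded_operator W1" "\<And>n. W1 (e n) = t1 n *\<^sub>C e (Suc n)"
    "\<And>x. norm (W1 x) \<le> \<epsilon> / m * norm x"
    using weighted_shift_exists[where t = t1, OF inj_Suc t1] by blast
  have inj2: "inj (\<lambda>n. Suc (Suc n))"
    by (simp add: inj_def)
  obtain W2 where W2: "bounded_operator W2" "\<And>n. W2 (e n) = t2 n *\<^sub>C e (Suc (Suc n))"
    "\<And>x. norm (W2 x) \<le> (\<beta> + \<epsilon>) / m * norm x"
    using weighted_shift_exists[where t = t2, OF inj2 t2] by blast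
  define Q where "Q x = x - eproj e {..<N} x" for x
  have Q: "bounded_operator Q"
    unfolding Q_def[abs_def]
    by (intro bounded_operator_minus bounded_operator_ident bounded_operator_eproj)
  have Qe: "Q (e n) = (if n \<ge> N then e n else 0)" for n
    by (simp add: Q_def eproj_basis)
  have eprojQ: "eproj e {..<N} (Q x) = 0" for x
    unfolding Q_def by (subst eproj_def) (simp add: cinner_eproj_residual[OF on])
  have QQ: "Q (Q x) = Q x" for x
    using eprojQ[of x] by (simp add: Q_def[of "Q x"])
  have QW1: "Q (W1 x) = W1 x" for x
    using weighted_shift_orthogonal[OF W1(1,2), of "{..<N}" x] by (simp add: Q_def t1_def)
  have QW2: "Q (W2 x) = W2 x" for x
    using weighted_shift_orthogonal[OF W2(1,2), of "{..<N}" x] by (simp add: Q_def t2_def)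
  note V' = bounded_operator_cadjoint[OF V(1)] and R' = bounded_operator_cadjoint[OF R(1)]
  have bT: "bounded_operator T"
    unfolding TRV by (rule bounded_operator_plus[OF R(1) V(1)])
  define S where "S x = cadjoint T x - cnj \<gamma> *\<^sub>C x" for x
  have adjT: "cadjoint T = (\<lambda>x. cadjoint R x + cadjoint V x)"
    by (rule cadjoint_eqI[OF bT])
      (simp add: TRV cinner_algebra cinner_cadjoint_left[OF R(1)] cinner_cadjoint_left[OF V(1)])
  have S: "bounded_operator S"
    unfolding S_def[abs_def]
    by (intro bounded_operator_minus bounded_operator_cadjoint bT bounded_operator_scalar)
  define F where "F x = W1 x + W2 x + Q (cadjoint V (J x))" for x
  have F: "bounded_operator F"
    unfolding F_def[abs_def]
    by (intro bounded_operator_plus W1(1) W2(1) bounded_operator_compose[OF Q]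
        bounded_operator_compose[OF V'] J(1))
  have QF: "Q (F x) = F x" for x
    by (simp add: F_def bounded_operator_add[OF Q] QW1 QW2 QQ)
  define q where "q = (\<beta> + 3 * \<epsilon>) / m"
  have q: "0 \<le> q" "q < 1"
    using lim(1,2) m by (auto simp: q_def m_def \<epsilon>_def field_simps)
  have F_norm: "norm (F x) \<le> q * norm x" for x
  proof -
    have "norm (Q (cadjoint V (J x))) \<le> \<epsilon> * (1 / m * norm x)"
      using order_trans[OF tail[of "J x"] mult_left_mono[OF J(3)[of x], of \<epsilon>]] \<epsilon> by (simp add: Q_def)
    moreover have "norm (F x) \<le> norm (W1 x) + norm (W2 x) + norm (Q (cadjoint V (J x)))"
      unfolding F_def by (meson norm_triangle_ineq norm_triangle_le add_right_mono order_trans)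
    moreover have "q * norm x = \<epsilon> / m * norm x + (\<beta> + \<epsilon>) / m * norm x + \<epsilon> * (1 / m * norm x)"
      using m by (simp add: q_def field_simps)
    ultimately show ?thesis
      using W1(3)[of x] W2(3)[of x] by linarith
  qed
  have RJ: "Q (cadjoint R (J x) - cnj \<gamma> *\<^sub>C J x) = Q x + W1 x + W2 x" for x
  proof (rule operator_eqI[of "\<lambda>x. Q (cadjoint R (J x) - cnj \<gamma> *\<^sub>C J x)" "\<lambda>x. Q x + W1 x + W2 x"])
    show "bounded_operator (\<lambda>x. Q (cadjoint R (J x) - cnj \<gamma> *\<^sub>C J x))"
      by (intro bounded_operator_compose[OF Q] bounded_operator_minus bounded_operator_compose[OF R']
          bounded_operator_scaleC_comp J(1))
    show "bounded_operator (\<lambda>x. Q x + W1 x + W2 x)"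
      by (intro bounded_operator_plus Q W1(1) W2(1))
    fix n
    show "Q (cadjoint R (J (e n)) - cnj \<gamma> *\<^sub>C J (e n)) = Q (e n) + W1 (e n) + W2 (e n)"
    proof (cases "n \<ge> N")
      case False
      then show ?thesis
        using Q R' by (simp add: J(2) W1(2) W2(2) Qe tJ_def t1_def t2_def)
    next
      case True
      have "cadjoint R (e (Suc n)) =
          cnj (a n) *\<^sub>C e n + cnj (c (Suc n)) *\<^sub>C e (Suc n) + cnj (b (Suc n)) *\<^sub>C e (Suc (Suc n))"
        using tridiagonal_Suc[OF tridiagonal_cadjoint[OF R], of n]
        unfolding cinner_cadjoint_left[OF R(1)] a_def b_def c_def cinner_commute[of _ "R _", symmetric] .
      then show ?thesis
        using True a0[OF True]
        by (simp add: J(2) W1(2) W2(2) tJ_def t1_def t2_def Qe scaleC_scaleC scaleC_add_right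
            bounded_operator_algebra[OF R'] bounded_operator_algebra[OF Q]
            diff_divide_distrib complex_vector.scale_left_diff_distrib)
    qed
  qed
  have QSJ: "Q (S (J x)) = Q x + F x" for x
  proof -
    have "S (J x) = (cadjoint R (J x) - cnj \<gamma> *\<^sub>C J x) + cadjoint V (J x)"
      by (simp add: S_def adjT)
    then show ?thesis
      by (simp add: bounded_operator_add[OF Q] RJ F_def)
  qed
  have "\<exists>z. Q (S (J z)) = Q (S (e i))" for i
  proof -
    \<comment> \<open>The equation is solved on the whole space; applying \<open>Q\<close>, which
      fixes \<open>F z\<close> and the right-hand side, turns \<open>z + F z\<close> into
      \<open>Q z + F z = Q (S (J z))\<close>.\<close>
    obtain z where z: "z + F z = Q (S (e i))"
      using neumann_surjective[OF F F_norm q] by metis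
    then have "Q z + F z = Q (S (e i))"
      by (metis QF QQ bounded_operator_add[OF Q])
    then show ?thesis
      by (metis QSJ)
  qed
  then obtain z where z: "\<And>i. Q (S (J (z i))) = Q (S (e i))"
    by metis
  \<comment> \<open>The correction by \<open>J (z i)\<close> cancels all coordinates of
    \<open>S (e i)\<close> from \<open>N\<close> onwards, so \<open>S\<close> maps
    \<open>w 0, ..., w N\<close> into a space of dimension at most \<open>N\<close>.\<close>
  define w where "w i = e i - J (z i)" for i
  have "S (w i) \<in> complex_vector.span (e ` {..<N})" for i
  proof -
    have "Q (S (w i)) = 0"
      by (simp add: w_def bounded_operator_diff[OF S] bounded_operator_diff[OF Q] z)
    then have "S (w i) = (\<Sum>j<N. cinner (S (w i)) (e j) *\<^sub>C e j)"
      by (simp add: Q_def eproj_def)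
    also have "\<dots> \<in> complex_vector.span (e ` {..<N})"
      by (intro complex_vector.span_sum complex_vector.span_scale complex_vector.span_base) auto
    finally show ?thesis .
  qed
  moreover have "card (e ` {..<N}) \<le> N"
    using card_image_le[of "{..<N}" e] by simp
  ultimately obtain t where t: "\<exists>i\<le>N. t i \<noteq> 0" "(\<Sum>i\<le>N. t i *\<^sub>C S (w i)) = 0"
    using linear_dependence[of "e ` {..<N}" N "\<lambda>i. S (w i)"] by (metis finite_imageI finite_lessThan)
  define x where "x = (\<Sum>i\<le>N. t i *\<^sub>C w i)"
  \<comment> \<open>The bound includes \<open>j = N\<close>, since \<open>J\<close> starts at
    \<open>e N\<close> and raises the index by one. Hence \<open>w 0, ..., w N\<close> have the
    first \<open>N + 1\<close> coordinates of basis vectors, and a nontrivial combination of them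
    cannot vanish.\<close>
  have Jz: "cinner (J y) (e j) = 0" if "j \<le> N" for y j
  proof -
    have "eproj e {..N} (J y) = 0"
      by (rule weighted_shift_orthogonal[OF J(1,2)]) (auto simp: tJ_def)
    then show ?thesis
      using cinner_eproj_residual[OF on, of "{..N}" j "J y"] that by simp
  qed
  have "cinner x (e j) = t j" if "j \<le> N" for j
  proof -
    have "cinner x (e j) = (\<Sum>i\<le>N. if i = j then t i else 0)"
      unfolding x_def cinner_sum_left
      by (intro sum.cong) (auto simp: cinner_scaleC_left w_def cinner_diff_left Jz[OF that])
    then show ?thesis using that by simp
  qed
  with t(1) have "x \<noteq> 0"
    by (metis cinner_zero_left)
  moreover have "S x = 0"
    using t(2) by (simp add: x_def bounded_operator_sum[OF S] bounded_operator_scaleC[OF S])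
  ultimately show ?thesis
    using that by (simp add: S_def)
qed

end

section \<open>Normal operators\<close>

fun sqrt_bound :: "nat \<Rightarrow> real" where
  "sqrt_bound 0 = 0"
| "sqrt_bound (Suc n) = (1 + (sqrt_bound n)\<^sup>2) / 2"

lemma sqrt_bound_range: "0 \<le> sqrt_bound n \<and> sqrt_bound n \<le> 1"
proof (induction n)
  case (Suc n)
  then show ?case
    using power_mono[of "sqrt_bound n" 1 2] by simp
qed simp

text \<open>Each increment equals \<open>(sqrt_bound n - 1)^2 / 2\<close>, hence is nonnegative, and
  the increments telescope to at most 1. Only summability is available: 1 is a double root of the
  fixed-point equation, so there is no contraction factor below one.\<close>

lemma sqrt_bound_summable: "summable (\<lambda>n. sqrt_bound (Suc n) - sqrt_bound n)"
proof -
  have "(\<Sum>i<n. sqrt_bound (Suc i) - sqrt_bound i) \<le> 1" for n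
    unfolding sum_lessThan_telescope using sqrt_bound_range[of n] by simp
  moreover have "sqrt_bound (Suc n) - sqrt_bound n \<ge> 0" for n
    using zero_le_power2[of "sqrt_bound n - 1"] by (simp add: power2_diff)
  ultimately show ?thesis
    by (intro summableI_nonneg_bounded)
qed

fun sqrt_iter :: "('a::complex_hilbert_space \<Rightarrow> 'a) \<Rightarrow> nat \<Rightarrow> 'a \<Rightarrow> 'a" where
  "sqrt_iter X 0 x = 0"
| "sqrt_iter X (Suc n) x = (1 / 2) *\<^sub>C (X x + sqrt_iter X n (sqrt_iter X n x))"

text \<open>
  The fixed point \<open>Y\<close> of \<open>Y = (X + Y\<^sup>2) / 2\<close> satisfies \<open>(1 - Y)\<^sup>2 = 1 - X\<close>, so \<open>1 - Y\<close> is a square root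
  of \<open>1 - X\<close>. The iterates are dominated by the scalar iteration for \<open>X = 1\<close>.
\<close>

lemma contraction_sqrt:
  fixes X :: "'a::complex_hilbert_space \<Rightarrow> 'a"
  assumes X: "bounded_operator X" and X1: "\<And>x. norm (X x) \<le> norm x"
  obtains Y where "bounded_operator Y" "\<And>x. norm (Y x) \<le> norm x"
    "\<And>x. 2 *\<^sub>C Y x = X x + Y (Y x)"
    "\<And>A x. bounded_operator A \<Longrightarrow> (\<And>x. A (X x) = X (A x)) \<Longrightarrow> A (Y x) = Y (A x)"
proof -
  let ?Y = "sqrt_iter X" and ?s = sqrt_bound
  have bY: "bounded_operator (?Y n)" for n
  proof (induction n)
    case 0
    show ?case by (rule bounded_operator_intro[where K = 0]) auto
  next
    case (Suc n)
    have "bounded_operator (\<lambda>x. (1 / 2) *\<^sub>C (X x + ?Y n (?Y n x)))"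
      by (intro bounded_operator_scaleC_comp bounded_operator_plus X bounded_operator_compose[OF Suc] Suc)
    moreover have "?Y (Suc n) = (\<lambda>x. (1 / 2) *\<^sub>C (X x + ?Y n (?Y n x)))"
      by (rule ext) simp
    ultimately show ?case by simp
  qed
  have Yn: "norm (?Y n x) \<le> ?s n * norm x" for n x
  proof (induction n arbitrary: x)
    case (Suc n)
    have "norm (?Y n (?Y n x)) \<le> ?s n * (?s n * norm x)"
      using order_trans[OF Suc[of "?Y n x"] mult_left_mono[OF Suc[of x]]] sqrt_bound_range by blast
    then have "norm (X x + ?Y n (?Y n x)) \<le> norm x + (?s n)\<^sup>2 * norm x"
      using X1[of x] norm_triangle_ineq[of "X x" "?Y n (?Y n x)"] by (simp add: power2_eq_square)
    moreover have "?s (Suc n) * norm x = (norm x + (?s n)\<^sup>2 * norm x) / 2"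
      by (simp add: distrib_right)
    ultimately show ?case
      by (simp add: norm_scaleC norm_divide del: sqrt_bound.simps)
  qed simp
  have Y1: "norm (?Y n x) \<le> norm x" for n x
    using order_trans[OF Yn[of n x]] sqrt_bound_range[of n] by (simp add: mult_left_le_one_le)
  have incr: "norm (?Y (Suc n) x - ?Y n x) \<le> (?s (Suc n) - ?s n) * norm x" for n x
  proof (induction n arbitrary: x)
    case 0
    show ?case using X1[of x] by (simp add: norm_scaleC norm_divide)
  next
    case (Suc n)
    let ?p = "?Y (Suc n)" and ?q = "?Y n"
    \<comment> \<open>Inserting \<open>?p (?q x)\<close> splits the difference of squares so that
      the two bounds add up to \<open>(s' + s) * (s' - s)\<close>, with \<open>s'\<close> and
      \<open>s\<close> the scalar iterates. This is exactly twice the next scalar increment.\<close>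
    have eq: "?Y (Suc (Suc n)) x - ?p x = (1 / 2) *\<^sub>C (?p (?p x - ?q x) + (?p (?q x) - ?q (?q x)))"
      unfolding sqrt_iter.simps(2)[of X "Suc n"] bounded_operator_diff[OF bY]
      unfolding sqrt_iter.simps(2)[of X n x]
      by (simp add: complex_vector.scale_right_diff_distrib scaleC_add_right)
    have "norm (?p (?p x - ?q x)) \<le> ?s (Suc n) * ((?s (Suc n) - ?s n) * norm x)"
      by (rule order_trans[OF Yn mult_left_mono[OF Suc]]) (use sqrt_bound_range in blast)
    moreover have "norm (?p (?q x) - ?q (?q x)) \<le> (?s (Suc n) - ?s n) * (?s n * norm x)"
      by (rule order_trans[OF Suc mult_left_mono[OF Yn]])
        (use zero_le_power2[of "?s n - 1"] in \<open>simp add: power2_diff\<close>)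
    ultimately have "norm (?p (?p x - ?q x) + (?p (?q x) - ?q (?q x)))
        \<le> ?s (Suc n) * ((?s (Suc n) - ?s n) * norm x) + (?s (Suc n) - ?s n) * (?s n * norm x)"
      by (meson add_mono norm_triangle_ineq order_trans)
    then have "norm (?Y (Suc (Suc n)) x - ?p x)
        \<le> (?s (Suc n) * ((?s (Suc n) - ?s n) * norm x) + (?s (Suc n) - ?s n) * (?s n * norm x)) / 2"
      unfolding eq by (simp add: norm_scaleC norm_divide)
    also have "\<dots> = ((?s (Suc n))\<^sup>2 - (?s n)\<^sup>2) / 2 * norm x"
    proof -
      have "p * ((p - q) * k) + (p - q) * (q * k) = (p\<^sup>2 - q\<^sup>2) * k" for p q k :: real
        by (simp add: power2_eq_square algebra_simps)
      then show ?thesis by (simp only: times_divide_eq_left)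
    qed
    also have "((?s (Suc n))\<^sup>2 - (?s n)\<^sup>2) / 2 = ?s (Suc (Suc n)) - ?s (Suc n)"
      unfolding sqrt_bound.simps(2)[of "Suc n"] by (subst (3) sqrt_bound.simps(2)) (simp add: field_simps)
    finally show ?case .
  qed
  have "convergent (\<lambda>n. ?Y n x)" for x
  proof (rule summable_increments_convergent)
    show "summable (\<lambda>n. norm (?Y (Suc n) x - ?Y n x))"
      using incr[of _ x]
      by (intro summable_comparison_test'[OF summable_mult2[OF sqrt_bound_summable, of "norm x"], of 0])
        (simp del: sqrt_iter.simps sqrt_bound.simps)
  qed
  then obtain Y where Y: "\<And>x. (\<lambda>n. ?Y n x) \<longlonglongrightarrow> Y x"
    unfolding convergent_def by metis
  have norm: "norm (Y x) \<le> 1 * norm x" for x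
    using LIMSEQ_le_const2[OF tendsto_norm[OF Y[of x]], of "norm x"] Y1 by auto
  have bYlim: "bounded_operator Y"
  proof (rule bounded_operator_intro[OF _ _ norm])
    fix x y c
    show "Y (x + y) = Y x + Y y"
      using LIMSEQ_unique[OF Y[of "x + y"]] tendsto_add[OF Y[of x] Y[of y]]
      by (simp add: bounded_operator_add[OF bY])
    show "Y (c *\<^sub>C x) = c *\<^sub>C Y x"
      using LIMSEQ_unique[OF Y[of "c *\<^sub>C x"]]
        bounded_linear.tendsto[OF bounded_bilinear.bounded_linear_right[OF bounded_bilinear_scaleC] Y[of x], of c]
      by (simp add: bounded_operator_scaleC[OF bY])
  qed
  \<comment> \<open>Convergence is only pointwise, but the iterates are uniformly contractive, so an
    error in the argument is not amplified.\<close>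
  have YY: "(\<lambda>n. ?Y n (?Y n x)) \<longlonglongrightarrow> Y (Y x)" for x
  proof -
    have "(\<lambda>n. ?Y n x - Y x) \<longlonglongrightarrow> 0"
      using Y[of x] by (simp add: LIM_zero_iff)
    then have "(\<lambda>n. norm (?Y n x - Y x)) \<longlonglongrightarrow> 0"
      by (simp add: tendsto_norm_zero)
    then have "(\<lambda>n. ?Y n (?Y n x - Y x)) \<longlonglongrightarrow> 0"
      by (rule Lim_null_comparison[rotated]) (simp add: Y1)
    from tendsto_add[OF this Y[of "Y x"]] show ?thesis
      by (simp add: bounded_operator_diff[OF bY])
  qed
  have "2 *\<^sub>C Y x = X x + Y (Y x)" for x
  proof (rule LIMSEQ_unique)
    show "(\<lambda>n. 2 *\<^sub>C ?Y (Suc n) x) \<longlonglongrightarrow> 2 *\<^sub>C Y x"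
      by (rule bounded_linear.tendsto[OF bounded_bilinear.bounded_linear_right[OF bounded_bilinear_scaleC]
          LIMSEQ_Suc[OF Y]])
    show "(\<lambda>n. 2 *\<^sub>C ?Y (Suc n) x) \<longlonglongrightarrow> X x + Y (Y x)"
      using tendsto_add[OF tendsto_const[of "X x"] YY[of x]] by (simp add: scaleC_scaleC)
  qed
  moreover have "A (Y x) = Y (A x)" if A: "bounded_operator A" and AX: "\<And>x. A (X x) = X (A x)" for A x
  proof (rule LIMSEQ_unique)
    have "A (?Y n x) = ?Y n (A x)" for n x
      by (induction n arbitrary: x)
        (simp_all add: bounded_operator_algebra[OF A] bounded_operator_zero[OF A] AX)
    then show "(\<lambda>n. A (?Y n x)) \<longlonglongrightarrow> Y (A x)"
      using Y by simp
    show "(\<lambda>n. A (?Y n x)) \<longlonglongrightarrow> A (Y x)"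
    proof -
      have "bounded_linear A"
        using A by (simp add: bounded_operator_def)
      then show ?thesis
        by (rule bounded_linear.tendsto[OF _ Y])
    qed
  qed
  ultimately show ?thesis
    using that[OF bYlim] norm by simp
qed

section \<open>Growth of orbits and hyperinvariance\<close>

text \<open>For normal \<open>A\<close> this is the spectral subspace of the closed disc of radius
  \<open>r\<close>. The unspecified \<open>C\<close> makes linearity and invariance under the
  commutant immediate, at the price that closedness has to be proved.\<close>

definition radial_space :: "('a::complex_hilbert_space \<Rightarrow> 'a) \<Rightarrow> real \<Rightarrow> 'a set" where
  "radial_space A r = {x. \<exists>C. \<forall>n. norm ((A ^^ n) x) \<le> C * r ^ n}"

text \<open>
  Log-convexity of \<open>n \<mapsto> norm ((A ^^ n) x)\<close> makes the growth condition defining the space equivalent to a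
  closed one.
\<close>

lemma radial_space_norm_le:
  fixes A :: "'a::complex_hilbert_space \<Rightarrow> 'a"
  assumes convex: "\<And>x. (norm (A x))\<^sup>2 \<le> norm (A (A x)) * norm x" and r: "r > 0"
    and x: "x \<in> radial_space A r"
  shows "norm (A x) \<le> r * norm x"
proof (rule ccontr)
  assume "\<not> ?thesis"
  then have gt: "norm (A x) > r * norm x" by simp
  have x0: "norm x > 0"
  proof -
    have "A 0 = 0"
      using convex[of 0] by simp
    then show ?thesis
      using gt by auto
  qed
  define s where "s = norm (A x) / norm x"
  have s: "s > r" "s > 0"
    using gt x0 r less_trans[of 0 r s] by (simp_all add: s_def pos_less_divide_eq)
  \<comment> \<open>By log-convexity the ratios of consecutive norms never decrease. A first ratio
    \<open>s > r\<close> therefore forces growth at least like \<open>s ^ n\<close>, which no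
    multiple of \<open>r ^ n\<close> dominates.\<close>
  have step: "norm ((A ^^ Suc n) x) \<ge> s * norm ((A ^^ n) x) \<and> norm ((A ^^ n) x) > 0" for n
  proof (induction n)
    case 0
    show ?case using x0 by (simp add: s_def)
  next
    case (Suc n)
    let ?p = "norm ((A ^^ n) x)" and ?q = "norm ((A ^^ Suc n) x)"
    have p: "?p > 0" and q: "?q \<ge> s * ?p"
      using Suc by auto
    have q0: "?q > 0"
      using q mult_pos_pos[OF s(2) p] by linarith
    have "s * ?p * ?q \<le> ?q * ?q"
      using q q0 by simp
    also have "\<dots> \<le> norm ((A ^^ Suc (Suc n)) x) * ?p"
      using convex[of "(A ^^ n) x"] by (simp add: power2_eq_square)
    finally have "s * ?q * ?p \<le> norm ((A ^^ Suc (Suc n)) x) * ?p"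
      by (simp only: mult_ac)
    then show ?case
      using p q0 by simp
  qed
  have lower: "s ^ n * norm x \<le> norm ((A ^^ n) x)" for n
  proof (induction n)
    case (Suc n)
    have "s * (s ^ n * norm x) \<le> s * norm ((A ^^ n) x)"
      using Suc s(2) by simp
    with step[of n] show ?case
      by (simp add: mult.assoc)
  qed simp
  obtain C where C: "\<And>n. norm ((A ^^ n) x) \<le> C * r ^ n"
    using x by (auto simp: radial_space_def)
  obtain n where "C / norm x < (s / r) ^ n"
    using real_arch_pow[of "s / r" "C / norm x"] s(1) r by auto
  then have "C * r ^ n < s ^ n * norm x"
    using x0 r by (simp add: field_simps power_divide)
  then show False
    using lower[of n] C[of n] by linarith
qed

lemma radial_space_hyperinvariant:
  fixes A T :: "'a::complex_hilbert_space \<Rightarrow> 'a"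
  assumes A: "bounded_operator A"
    and convex: "\<And>x. (norm (A x))\<^sup>2 \<le> norm (A (A x)) * norm x" and r: "r > 0"
    and comm: "\<And>S x. bounded_operator S \<Longrightarrow> S \<circ> T = T \<circ> S \<Longrightarrow> S (A x) = A (S x)"
  shows "hyperinvariant T (radial_space A r)"
  unfolding hyperinvariant_def
proof (intro conjI allI impI)
  have bpow: "bounded_operator (A ^^ n)" for n
  proof (induction n)
    case 0
    show ?case using bounded_operator_ident by (simp add: id_def)
  next
    case (Suc n)
    show ?case using bounded_operator_compose[OF A Suc] by (simp add: comp_def)
  qed
  show "complex_vector.subspace (radial_space A r)"
  proof (rule complex_vector.subspaceI)
    show "0 \<in> radial_space A r"
      using bpow by (auto simp: radial_space_def intro!: exI[of _ 0])
  next
    fix x y assume "x \<in> radial_space A r" "y \<in> radial_space A r"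
    then obtain C C' where "\<And>n. norm ((A ^^ n) x) \<le> C * r ^ n" "\<And>n. norm ((A ^^ n) y) \<le> C' * r ^ n"
      by (auto simp: radial_space_def)
    then have "norm ((A ^^ n) (x + y)) \<le> (C + C') * r ^ n" for n
      unfolding bounded_operator_add[OF bpow] distrib_right
      by (meson add_mono norm_triangle_ineq order_trans)
    then show "x + y \<in> radial_space A r"
      by (auto simp: radial_space_def)
  next
    fix x c assume "x \<in> radial_space A r"
    then obtain C where "\<And>n. norm ((A ^^ n) x) \<le> C * r ^ n"
      by (auto simp: radial_space_def)
    then have "norm ((A ^^ n) (c *\<^sub>C x)) \<le> (cmod c * C) * r ^ n" for n
      unfolding bounded_operator_scaleC[OF bpow] norm_scaleC by (simp add: mult.assoc mult_left_mono)
    then show "c *\<^sub>C x \<in> radial_space A r"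
      by (auto simp: radial_space_def)
  qed
  \<comment> \<open>Orbits stay in the space, so the one-step bound can be iterated. Thus
    \<open>C = norm x\<close> always suffices, and the space is an intersection of closed
    sets.\<close>
  have "norm ((A ^^ n) x) \<le> r ^ n * norm x" if x: "x \<in> radial_space A r" for x n
  proof (induction n)
    case (Suc n)
    have "(A ^^ n) x \<in> radial_space A r"
    proof -
      obtain C where C: "\<And>n. norm ((A ^^ n) x) \<le> C * r ^ n"
        using x by (auto simp: radial_space_def)
      have "norm ((A ^^ k) ((A ^^ n) x)) \<le> (C * r ^ n) * r ^ k" for k
        using C[of "k + n"] by (simp add: funpow_add power_add mult_ac)
      then show ?thesis
        by (auto simp: radial_space_def)
    qed
    from radial_space_norm_le[OF convex r this]
    have "norm ((A ^^ Suc n) x) \<le> r * norm ((A ^^ n) x)"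
      by simp
    also have "\<dots> \<le> r * (r ^ n * norm x)"
      using Suc r by simp
    finally show ?case
      by (simp add: mult.assoc)
  qed simp
  then have "radial_space A r = {x. \<forall>n. norm ((A ^^ n) x) \<le> r ^ n * norm x}"
    by (auto simp: radial_space_def mult.commute)
  moreover have "closed {x. \<forall>n. norm ((A ^^ n) x) \<le> r ^ n * norm x}"
    using bpow by (intro closed_Collect_all closed_Collect_le continuous_intros
        linear_continuous_on) (auto simp: bounded_operator_def)
  ultimately show "closed (radial_space A r)"
    by simp
next
  fix S :: "'a \<Rightarrow> 'a" assume S: "bounded_operator S \<and> S \<circ> T = T \<circ> S"
  then obtain K where K: "K > 0" "\<And>x. norm (S x) \<le> K * norm x"
    using bounded_operator_bound by metis
  have "(A ^^ n) (S x) = S ((A ^^ n) x)" for n x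
    using comm S by (induction n) auto
  then have S_le: "norm ((A ^^ n) (S x)) \<le> K * norm ((A ^^ n) x)" for n x
    using K(2) by simp
  show "S ` radial_space A r \<subseteq> radial_space A r"
  proof
    fix y assume "y \<in> S ` radial_space A r"
    then obtain x C where "y = S x" "\<And>n. norm ((A ^^ n) x) \<le> C * r ^ n"
      by (auto simp: radial_space_def)
    then have "norm ((A ^^ n) y) \<le> (K * C) * r ^ n" for n
      using order_trans[OF S_le[of n x] mult_left_mono[of _ "C * r ^ n" K]] K(1) by simp
    then show "y \<in> radial_space A r"
      by (auto simp: radial_space_def)
  qed
qed

text \<open>Otherwise every \<open>T - \<mu>\<close> multiplies all norms by a constant. The
  constants for the shifts 0, 1 and \<open>\<i>\<close> determine \<open>cinner (T x) x\<close> as a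
  fixed multiple of \<open>cinner x x\<close>, and an operator whose numerical range is a point is
  scalar.\<close>

lemma nonscalar_shift:
  fixes T :: "'a::complex_hilbert_space \<Rightarrow> 'a"
  assumes T: "bounded_operator T" and nonscalar: "\<not> (\<exists>c. T = (\<lambda>x. c *\<^sub>C x))"
  obtains \<mu> x y r where "r > 0" "norm (T x - \<mu> *\<^sub>C x) < r * norm x" "norm (T y - \<mu> *\<^sub>C y) > r * norm y"
proof (rule ccontr)
  note shift_witness = that
  assume no: "\<not> thesis"
  have le: "norm (T x - \<mu> *\<^sub>C x) * norm y \<ge> norm (T y - \<mu> *\<^sub>C y) * norm x" for \<mu> x y
  proof (rule ccontr)
    let ?a = "norm (T x - \<mu> *\<^sub>C x)" and ?b = "norm (T y - \<mu> *\<^sub>C y)"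
    assume "\<not> ?thesis"
    then have lt: "?a * norm y < ?b * norm x" by simp
    have x: "norm x > 0" and y: "norm y > 0"
      using lt T by (auto intro!: Nat.gr0I)
    have "?a / norm x < ?b / norm y"
      using lt x y by (simp add: field_simps)
    then obtain r where r: "?a / norm x < r" "r < ?b / norm y"
      using dense by blast
    then have "r > 0"
      using x by (meson divide_nonneg_pos le_less_trans norm_ge_zero)
    then have thesis
      using r x y by (intro shift_witness[of r x \<mu> y]) (auto simp: field_simps)
    with no show False ..
  qed
  have const: "\<exists>k. \<forall>x. (norm (T x - \<mu> *\<^sub>C x))\<^sup>2 = k * (norm x)\<^sup>2" for \<mu>
  proof (cases "\<exists>y :: 'a. y \<noteq> 0")
    case True
    then obtain y :: 'a where y: "norm y > 0" by auto
    have "norm (T x - \<mu> *\<^sub>C x) * norm y = norm (T y - \<mu> *\<^sub>C y) * norm x" for x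
      using le[of y \<mu> x] le[of x \<mu> y] by linarith
    then have "norm (T x - \<mu> *\<^sub>C x) = norm (T y - \<mu> *\<^sub>C y) / norm y * norm x" for x
      using y by (simp add: field_simps)
    then show ?thesis
      by (metis power_mult_distrib)
  next
    case False
    then have zero: "x = 0" for x :: 'a
      by blast
    have "(norm (T x - \<mu> *\<^sub>C x))\<^sup>2 = 0 * (norm x)\<^sup>2" for x
      using zero[of "T x - \<mu> *\<^sub>C x"] by simp
    then show ?thesis by blast
  qed
  obtain k0 k1 k2 where k: "\<And>x. (norm (T x - 0 *\<^sub>C x))\<^sup>2 = k0 * (norm x)\<^sup>2"
    "\<And>x. (norm (T x - 1 *\<^sub>C x))\<^sup>2 = k1 * (norm x)\<^sup>2" "\<And>x. (norm (T x - \<i> *\<^sub>C x))\<^sup>2 = k2 * (norm x)\<^sup>2"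
    using const[of 0] const[of 1] const[of \<i>] by blast
  have expand: "(norm (T x - \<mu> *\<^sub>C x))\<^sup>2 =
      (norm (T x))\<^sup>2 - 2 * Re (cnj \<mu> * cinner (T x) x) + (cmod \<mu>)\<^sup>2 * (norm x)\<^sup>2" for \<mu> x
  proof -
    have "(cmod \<mu>)\<^sup>2 * (norm x)\<^sup>2 = (norm (\<mu> *\<^sub>C x))\<^sup>2"
      by (simp add: norm_scaleC power_mult_distrib)
    moreover have "Re (cinner (\<mu> *\<^sub>C x) (T x)) = Re (cinner (T x) (\<mu> *\<^sub>C x))"
      by (metis cinner_commute complex_cnj_cnj cnj.sel(1))
    ultimately show ?thesis
      by (simp only: norm_eq_cinner cinner_diff_left cinner_diff_right)
        (simp add: cinner_scaleC_right)
  qed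
  \<comment> \<open>Obtained by subtracting the expansions of the squared norms: shift 1 against
    shift 0 gives the real part, shift \<open>\<i>\<close> against shift 0 the imaginary
    part.\<close>
  define \<nu> where "\<nu> = Complex ((k0 - k1 + 1) / 2) ((k0 - k2 + 1) / 2)"
  have "cinner (T x) x = \<nu> * cinner x x" for x
    using k(1)[of x] k(2)[of x] k(3)[of x]
    unfolding expand cinner_self by (simp add: complex_eq_iff \<nu>_def field_simps)
  then have "cinner (T x - \<nu> *\<^sub>C x) x = 0" for x
    by (simp add: cinner_diff_left cinner_scaleC_left)
  \<comment> \<open>A form that vanishes identically is in particular positive, which makes
    \<open>positive_operator_null\<close> applicable.\<close>
  moreover from this have "positive_operator (\<lambda>x. T x - \<nu> *\<^sub>C x)"
    by (simp add: positive_operator_def bounded_operator_minus T bounded_operator_scalar)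
  ultimately have "T x - \<nu> *\<^sub>C x = 0" for x
    using positive_operator_null[of "\<lambda>x. T x - \<nu> *\<^sub>C x" x] by simp
  then have "T = (\<lambda>x. \<nu> *\<^sub>C x)"
    by auto
  with nonscalar show False by blast
qed

lemma closure_range_hyperinvariant:
  fixes T :: "'a::complex_hilbert_space \<Rightarrow> 'a"
  assumes T: "bounded_operator T"
  shows "hyperinvariant T (closure (range (\<lambda>x. T x - \<mu> *\<^sub>C x)))"
  unfolding hyperinvariant_def
proof (intro conjI allI impI)
  let ?A = "\<lambda>x. T x - \<mu> *\<^sub>C x"
  have A: "bounded_operator ?A"
    by (intro bounded_operator_minus T bounded_operator_scalar)
  show "complex_vector.subspace (closure (range ?A))"
  proof (rule complex_vector.subspaceI)
    have "0 = ?A 0"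
      using T by simp
    then have "0 \<in> range ?A"
      by (rule range_eqI)
    then show "0 \<in> closure (range ?A)"
      by (rule subsetD[OF closure_subset])
  next
    fix x y assume "x \<in> closure (range ?A)" "y \<in> closure (range ?A)"
    then obtain f g where f: "\<And>n. f n \<in> range ?A" "f \<longlonglongrightarrow> x" and g: "\<And>n. g n \<in> range ?A" "g \<longlonglongrightarrow> y"
      unfolding closure_sequential by blast
    have "f n + g n \<in> range ?A" for n
    proof -
      obtain p q where "f n = ?A p" "g n = ?A q"
        using f(1)[of n] g(1)[of n] by blast
      then have "f n + g n = ?A (p + q)"
        using bounded_operator_add[OF A, of p q] by simp
      then show ?thesis by (rule range_eqI)
    qed
    with tendsto_add[OF f(2) g(2)] show "x + y \<in> closure (range ?A)"
      unfolding closure_sequential by (intro exI[of _ "\<lambda>n. f n + g n"] conjI allI)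
  next
    fix x c assume "x \<in> closure (range ?A)"
    then obtain f where f: "\<And>n. f n \<in> range ?A" "f \<longlonglongrightarrow> x"
      unfolding closure_sequential by blast
    have "c *\<^sub>C f n \<in> range ?A" for n
    proof -
      obtain p where "f n = ?A p"
        using f(1)[of n] by blast
      then have "c *\<^sub>C f n = ?A (c *\<^sub>C p)"
        using bounded_operator_scaleC[OF A, of c p] by simp
      then show ?thesis by (rule range_eqI)
    qed
    moreover have "(\<lambda>n. c *\<^sub>C f n) \<longlonglongrightarrow> c *\<^sub>C x"
      by (rule bounded_linear.tendsto[OF bounded_bilinear.bounded_linear_right[OF bounded_bilinear_scaleC] f(2)])
    ultimately show "c *\<^sub>C x \<in> closure (range ?A)"
      unfolding closure_sequential by (intro exI[of _ "\<lambda>n. c *\<^sub>C f n"] conjI allI)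
  qed
  fix S :: "'a \<Rightarrow> 'a" assume S: "bounded_operator S \<and> S \<circ> T = T \<circ> S"
  then have "S (?A x) = ?A (S x)" for x
    by (simp add: bounded_operator_diff bounded_operator_scaleC fun_eq_iff)
  then have "S ` range ?A \<subseteq> range ?A"
    by auto
  then have "S ` range ?A \<subseteq> closure (range ?A)"
    using closure_subset by (rule order_trans)
  moreover have "continuous_on (closure (range ?A)) S"
    using S by (auto simp: bounded_operator_def intro: linear_continuous_on)
  ultimately show "S ` closure (range ?A) \<subseteq> closure (range ?A)"
    by (intro image_closure_subset) auto
qed simp

context hilbert_basis
begin

text \<open>\<open>y\<^sub>0\<close> is expanded too much to lie in the growth space. To see that
  the space is nonzero, \<open>x\<^sub>0\<close> is projected, up to scaling, onto the part where
  \<open>cadjoint A \<circ> A\<close> is at most \<open>r^2\<close>; a square root gives the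
  negative part of the difference and plays the role of the spectral theorem.\<close>

lemma normal_hyperinvariant:
  fixes T :: "'a \<Rightarrow> 'a"
  assumes T: "bounded_operator T" and nonscalar: "\<not> (\<exists>c. T = (\<lambda>x. c *\<^sub>C x))"
    and normal: "\<And>x. cadjoint T (T x) = T (cadjoint T x)"
  shows "\<exists>M. hyperinvariant T M \<and> M \<noteq> {0} \<and> M \<noteq> UNIV"
proof -
  obtain \<mu> x\<^sub>0 y\<^sub>0 r where r: "r > 0" and x\<^sub>0: "norm (T x\<^sub>0 - \<mu> *\<^sub>C x\<^sub>0) < r * norm x\<^sub>0"
    and y\<^sub>0: "norm (T y\<^sub>0 - \<mu> *\<^sub>C y\<^sub>0) > r * norm y\<^sub>0"
    using nonscalar_shift[OF T nonscalar] .
  define A where "A x = T x - \<mu> *\<^sub>C x" for x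
  define A' where "A' x = cadjoint T x - cnj \<mu> *\<^sub>C x" for x
  note T' = bounded_operator_cadjoint[OF T]
  have A: "bounded_operator A" and A': "bounded_operator A'"
    unfolding A_def[abs_def] A'_def[abs_def]
    by (intro bounded_operator_minus T T' bounded_operator_scalar)+
  have adj: "cinner (A' x) y = cinner x (A y)" "cinner (A x) y = cinner x (A' y)" for x y
    by (simp_all add: A_def A'_def cinner_algebra cinner_cadjoint_left[OF T] cinner_cadjoint_right[OF T])
  have AA': "A' (A x) = A (A' x)" for x
    by (simp add: A_def A'_def bounded_operator_algebra[OF T] bounded_operator_algebra[OF T'] normal
        complex_vector.scale_right_diff_distrib scaleC_scaleC algebra_simps)
  \<comment> \<open>Normality gives \<open>norm (A' (A x)) = norm (A (A x))\<close>, and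
    Cauchy-Schwarz applied to \<open>cinner (A' (A x)) x\<close> does the rest.\<close>
  have convex: "(norm (A x))\<^sup>2 \<le> norm (A (A x)) * norm x" for x
  proof -
    have "cinner (A' (A x)) (A' (A x)) = cinner (A (A x)) (A (A x))"
      by (metis adj AA')
    then have "(norm (A' (A x)))\<^sup>2 = (norm (A (A x)))\<^sup>2"
      by (simp add: norm_eq_cinner)
    then have "norm (A' (A x)) = norm (A (A x))"
      by simp
    moreover have "(norm (A x))\<^sup>2 = cmod (cinner (A' (A x)) x)"
      by (simp add: adj(1) cinner_self norm_power)
    ultimately show ?thesis
      using cinner_cauchy_schwarz[of "A' (A x)" x] by simp
  qed
  have hyper: "hyperinvariant T (radial_space A r)"
  proof (rule radial_space_hyperinvariant[OF A convex r])
    fix S :: "'a \<Rightarrow> 'a" and x assume "bounded_operator S" "S \<circ> T = T \<circ> S"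
    then show "S (A x) = A (S x)"
      by (simp add: A_def bounded_operator_diff bounded_operator_scaleC fun_eq_iff)
  qed
  have "y\<^sub>0 \<notin> radial_space A r"
    using radial_space_norm_le[OF convex r, of y\<^sub>0] y\<^sub>0 by (auto simp flip: A_def)
  moreover have "\<exists>x\<in>radial_space A r. x \<noteq> 0"
  proof -
    define P where "P x = A' (A x) - complex_of_real (r\<^sup>2) *\<^sub>C x" for x
    have P: "bounded_operator P"
      unfolding P_def[abs_def]
      by (intro bounded_operator_minus bounded_operator_compose[OF A' A] bounded_operator_scalar)
    obtain K where K: "K > 0" "\<And>x. norm (P x) \<le> K * norm x"
      using bounded_operator_bound[OF P] by metis
    \<comment> \<open>Scaling makes the hermitian \<open>Q\<close> a contraction, so that
      \<open>X = 1 - Q^2\<close> is one too and \<open>contraction_sqrt\<close> yields a square root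
      of \<open>1 - X = Q^2\<close>.\<close>
    define Q where "Q x = complex_of_real (1 / K) *\<^sub>C P x" for x
    have Q: "bounded_operator Q"
      unfolding Q_def[abs_def] by (rule bounded_operator_scaleC_comp[OF P])
    have Q1: "norm (Q x) \<le> norm x" for x
      using K(1) K(2)[of x] by (simp add: Q_def norm_scaleC norm_divide field_simps)
    have Q_herm: "cinner (Q x) y = cinner x (Q y)" for x y
      by (simp add: Q_def P_def cinner_algebra adj)
    have Q_form: "Re (cinner (Q x) x) = ((norm (A x))\<^sup>2 - r\<^sup>2 * (norm x)\<^sup>2) / K" for x
    proof -
      have "cinner (Q x) x = complex_of_real (((norm (A x))\<^sup>2 - r\<^sup>2 * (norm x)\<^sup>2) / K)"
        by (simp add: Q_def P_def cinner_algebra adj(1) cinner_self)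
      then show ?thesis by simp
    qed
    have AQ: "A (Q x) = Q (A x)" for x
      by (simp add: Q_def P_def bounded_operator_algebra[OF A] bounded_operator_algebra[OF A'] AA')
    define X where "X x = x - Q (Q x)" for x
    have X: "bounded_operator X"
      unfolding X_def[abs_def]
      by (intro bounded_operator_minus bounded_operator_ident bounded_operator_compose[OF Q Q])
    have X1: "norm (X x) \<le> norm x" for x
    proof (rule power2_le_imp_le)
      have "cinner (Q (Q x)) x = cinner (Q x) (Q x)" "cinner x (Q (Q x)) = cinner (Q x) (Q x)"
        by (simp_all add: Q_herm)
      then have "(norm (X x))\<^sup>2 = (norm x)\<^sup>2 - 2 * (norm (Q x))\<^sup>2 + (norm (Q (Q x)))\<^sup>2"
        unfolding X_def norm_eq_cinner cinner_diff_left cinner_diff_right by simp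
      moreover have "(norm (Q (Q x)))\<^sup>2 \<le> (norm (Q x))\<^sup>2"
        using Q1[of "Q x"] by (simp add: power_mono)
      ultimately show "(norm (X x))\<^sup>2 \<le> (norm x)\<^sup>2"
        using zero_le_power2[of "norm (Q x)"] by linarith
    qed simp
    obtain Y where Y: "bounded_operator Y" "\<And>x. norm (Y x) \<le> norm x"
      "\<And>x. 2 *\<^sub>C Y x = X x + Y (Y x)"
      "\<And>B x. bounded_operator B \<Longrightarrow> (\<And>x. B (X x) = X (B x)) \<Longrightarrow> B (Y x) = Y (B x)"
      using contraction_sqrt[OF X X1] by metis
    have QY: "Q (Y x) = Y (Q x)" for x
      by (rule Y(4)[OF Q]) (simp add: X_def bounded_operator_diff[OF Q])
    have AY: "A (Y x) = Y (A x)" for x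
      by (rule Y(4)[OF A]) (simp add: X_def bounded_operator_diff[OF A] AQ)
    text \<open>\<open>Z = |Q|\<close>, and \<open>B\<close> is twice the negative part of \<open>Q\<close>.\<close>
    define Z where "Z x = x - Y x" for x
    define B where "B x = Z x - Q x" for x
    have Z_pos: "Re (cinner (Z x) x) \<ge> 0" for x
    proof -
      have "Re (cinner (Y x) x) \<le> norm (Y x) * norm x"
        using cinner_cauchy_schwarz[of "Y x" x] complex_Re_le_cmod order_trans by blast
      also have "\<dots> \<le> norm x * norm x"
        by (rule mult_right_mono[OF Y(2)]) simp
      finally show ?thesis
        by (simp add: Z_def cinner_diff_left power2_eq_square flip: norm_eq_cinner)
    qed
    have ZZ: "Z (Z x) = Q (Q x)" for x
    proof -
      have "Z (Z x) = x - (Y x + Y x) + Y (Y x)"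
        by (simp add: Z_def bounded_operator_diff[OF Y(1)])
      moreover have "Y x + Y x = 2 *\<^sub>C Y x"
        using scaleC_add_left[of 1 1 "Y x"] by simp
      ultimately show ?thesis
        by (simp add: Y(3) X_def)
    qed
    have QB: "Q (B x) = - Z (B x)" for x
    proof -
      have "Z (Q x) = Q (Z x)"
        by (simp add: Z_def bounded_operator_diff[OF Q] QY)
      moreover have "Z (B x) = Z (Z x) - Z (Q x)"
        by (simp add: B_def Z_def bounded_operator_diff[OF Y(1)])
      ultimately show ?thesis
        by (simp add: ZZ B_def bounded_operator_diff[OF Q])
    qed
    have AB: "A (B x) = B (A x)" for x
      by (simp add: B_def Z_def bounded_operator_diff[OF A] AQ AY)
    \<comment> \<open>On the range of \<open>B\<close> the operator \<open>Q\<close> acts as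
      \<open>- Z\<close>, so its form is nonpositive there. Since \<open>B\<close> commutes with
      \<open>A\<close>, orbits never leave this range and the estimate can be repeated.\<close>
    have A_B_le: "norm (A (B x)) \<le> r * norm (B x)" for x
    proof (rule power2_le_imp_le)
      have "Re (cinner (Q (B x)) (B x)) \<le> 0"
        using Z_pos[of "B x"] by (simp add: QB cinner_minus_left)
      then show "(norm (A (B x)))\<^sup>2 \<le> (r * norm (B x))\<^sup>2"
        using K(1) by (simp add: Q_form divide_le_0_iff power_mult_distrib)
    qed (use r in simp)
    have "norm ((A ^^ n) (B x)) \<le> r ^ n * norm (B x)" for n x
    proof (induction n)
      case (Suc n)
      have "(A ^^ n) (B x) = B ((A ^^ n) x)"
        by (induction n) (simp_all add: AB)
      then have "norm ((A ^^ Suc n) (B x)) \<le> r * norm ((A ^^ n) (B x))"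
        using A_B_le by simp
      also have "\<dots> \<le> r * (r ^ n * norm (B x))"
        using Suc r by simp
      finally show ?case by (simp add: mult.assoc)
    qed simp
    then have "B x \<in> radial_space A r" for x
      unfolding radial_space_def by (auto intro!: exI[of _ "norm (B x)"] simp: mult.commute)
    \<comment> \<open>If \<open>B x\<^sub>0\<close> vanished, \<open>Q\<close> would agree with the
      positive \<open>Z\<close> at \<open>x\<^sub>0\<close>, but its form is negative there by the
      choice of \<open>x\<^sub>0\<close>.\<close>
    moreover have "B x\<^sub>0 \<noteq> 0"
    proof
      assume "B x\<^sub>0 = 0"
      then have "Re (cinner (Q x\<^sub>0) x\<^sub>0) \<ge> 0"
        using Z_pos[of x\<^sub>0] by (simp add: B_def)
      moreover have "(norm (A x\<^sub>0))\<^sup>2 < r\<^sup>2 * (norm x\<^sub>0)\<^sup>2"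
        using power_strict_mono[OF x\<^sub>0[folded A_def], of 2] by (simp add: power_mult_distrib)
      ultimately show False
        using K(1) by (simp add: Q_form zero_le_divide_iff)
    qed
    ultimately show ?thesis by blast
  qed
  ultimately have "radial_space A r \<noteq> {0}" "radial_space A r \<noteq> UNIV"
    by auto
  with hyper show ?thesis by blast
qed

lemma eigenvector_hyperinvariant:
  fixes T :: "'a \<Rightarrow> 'a"
  assumes T: "bounded_operator T" and nonscalar: "\<not> (\<exists>c. T = (\<lambda>x. c *\<^sub>C x))"
    and x: "x \<noteq> 0" "cadjoint T x = cnj \<gamma> *\<^sub>C x"
  shows "\<exists>M. hyperinvariant T M \<and> M \<noteq> {0} \<and> M \<noteq> UNIV"
proof (intro exI conjI)
  let ?M = "closure (range (\<lambda>x. T x - \<gamma> *\<^sub>C x))"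
  show "hyperinvariant T ?M"
    by (rule closure_range_hyperinvariant[OF T])
  show "?M \<noteq> {0}"
  proof
    assume "?M = {0}"
    then have "range (\<lambda>x. T x - \<gamma> *\<^sub>C x) \<subseteq> {0}"
      using closure_subset[of "range (\<lambda>x. T x - \<gamma> *\<^sub>C x)"] by simp
    then have "T x - \<gamma> *\<^sub>C x = 0" for x
      by (simp only: image_subset_iff) simp
    then have "T = (\<lambda>x. \<gamma> *\<^sub>C x)"
      by auto
    with nonscalar show False by blast
  qed
  have "cinner (T y) x = \<gamma> * cinner y x" for y
    unfolding cinner_cadjoint_right[OF T, symmetric] x(2) by (simp add: cinner_scaleC_right)
  then have "cinner (T y - \<gamma> *\<^sub>C y) x = 0" for y
    by (simp add: cinner_diff_left cinner_scaleC_left)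
  moreover have "closed {y. cinner y x = 0}"
    by (intro closed_Collect_eq continuous_on_const
        linear_continuous_on[OF bounded_bilinear.bounded_linear_left[OF bounded_bilinear_cinner]])
  ultimately have "?M \<subseteq> {y. cinner y x = 0}"
    by (intro closure_minimal) auto
  moreover have "cinner x x \<noteq> 0"
    using x(1) by (simp add: cinner_self)
  ultimately show "?M \<noteq> UNIV"
    by blast
qed

end

theorem theorem2p6:
  fixes T :: "'a::complex_hilbert_space \<Rightarrow> 'a"
  assumes "infinite_dimensional TYPE('a)"
    and "separable_space (euclidean :: 'a topology)"
    and "hyponormal T"
    and "\<not> (\<exists>c. T = (\<lambda>x. c *\<^sub>C x))"
    and "\<exists>(e :: nat \<Rightarrow> 'a) R V. orthonormal_basis UNIV e \<and>
           bounded_operator R \<and> tridiagonal e R \<and> trace_class V \<and> T = (\<lambda>x. R x + V x)"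
  shows "\<exists>M. hyperinvariant T M \<and> M \<noteq> {0} \<and> M \<noteq> UNIV"
proof -
  obtain e R V where e: "orthonormal_basis UNIV (e :: nat \<Rightarrow> 'a)"
    and R: "bounded_operator R" "tridiagonal e R" and "trace_class V" and TRV: "T = (\<lambda>x. R x + V x)"
    using assms(5) by blast
  interpret hilbert_basis e
    using e by unfold_locales
  have V: "bounded_operator V"
    using \<open>trace_class V\<close> by (simp add: trace_class_def)
  obtain u v where uv: "nuclear_rep V u v"
    using trace_class_nuclear[OF \<open>trace_class V\<close>] .
  note T = hyponormal_bounded[OF assms(3)]
  show ?thesis
  \<comment> \<open>Equality of these norms says that the form of \<open>D\<close> vanishes.
    Splitting on it, rather than on the trace \<open>d\<close>, keeps \<open>d\<close> internal to
    the lemma on the limits.\<close>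
  proof (cases "\<forall>x. norm (T x) = norm (cadjoint T x)")
    case True
    have D: "positive_operator (self_commutator T)"
      using assms(3) by (simp add: hyponormal_def)
    have "self_commutator T x = 0" for x
      using True by (intro positive_operator_null[OF D])
        (simp add: cinner_self_commutator[OF T] cinner_self)
    then show ?thesis
      by (intro normal_hyperinvariant[OF T assms(4)]) (simp add: self_commutator_def)
  next
    case False
    then obtain x where "norm (T x) \<noteq> norm (cadjoint T x)"
      by blast
    from almost_tridiagonal_hyponormal_limits[OF assms(3) this R V uv fun_cong[OF TRV]]
    obtain \<alpha> \<beta> \<gamma> where "0 \<le> \<beta>" "\<beta> < \<alpha>"
      "(\<lambda>n. cmod (cinner (R (e n)) (e (Suc n)))) \<longlonglongrightarrow> \<alpha>"
      "(\<lambda>n. cmod (cinner (R (e (Suc n))) (e n))) \<longlonglongrightarrow> \<beta>"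
      "(\<lambda>n. cinner (R (e n)) (e n)) \<longlonglongrightarrow> \<gamma>"
      by blast
    from adjoint_eigenvector[OF R V uv TRV this]
    obtain y where "y \<noteq> 0" "cadjoint T y = cnj \<gamma> *\<^sub>C y" .
    then show ?thesis
      by (rule eigenvector_hyperinvariant[OF T assms(4)])
  qed
qed

end
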